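(* Let $X$ be a compact metric space, $r>0$, and let $\mathcal{U}$ be a good open cover of $X$ such that for every finite subset $\sigma\subset X$: $\sigma$ is contained in some element of $\mathcal{U}$ iff $\operatorname{Diam}(\sigma)<r$. Then there exists a countable subset $C\subset X$ such that $\operatorname{Rips}(C,r)\simeq X$.
   Context: For $A\subset X$, $\operatorname{Rips}(A,r)$ is the simplicial complex (weak topology) with vertex set $A$ whose simplices are the finite subsets of $A$ of diameter $<r$. A cover is good if every finite intersection of its members is empty or contractible. *)

theory Defs
  imports "HOL-Analysis.Analysis"
begin

definition rips_simplices :: "'a::metric_space set \<Rightarrow> real \<Rightarrow> 'a set set" where
  "rips_simplices A r = {\<sigma>. \<sigma> \<subseteq> A \<and> finite \<sigma> \<and> \<sigma> \<noteq> {} \<and> diameter \<sigma> < r}"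

definition simplex_pts :: "'a set \<Rightarrow> ('a \<Rightarrow> real) set" where
  "simplex_pts \<sigma> = {f. (\<forall>x. x \<notin> \<sigma> \<longrightarrow> f x = 0) \<and> (\<forall>x. 0 \<le> f x) \<and> sum f \<sigma> = 1}"

definition realization_carrier :: "'a set set \<Rightarrow> ('a \<Rightarrow> real) set" where
  "realization_carrier K = \<Union> (simplex_pts ` K)"

text \<open>Geometric realization with the weak (coherent) topology: a set is open iff its
  intersection with every closed simplex is open in that simplex (Euclidean topology,
  i.e. subspace of the product topology on barycentric coordinates).\<close>
definition weak_realization :: "'a set set \<Rightarrow> ('a \<Rightarrow> real) topology" where
  "weak_realization K = topology (\<lambda>U. U \<subseteq> realization_carrier K \<and>
     (\<forall>\<sigma>\<in>K. openin (top_of_set (simplex_pts \<sigma>)) (U \<inter> simplex_pts \<sigma>)))"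

definition Rips :: "'a::metric_space set \<Rightarrow> real \<Rightarrow> ('a \<Rightarrow> real) topology" where
  "Rips A r = weak_realization (rips_simplices A r)"

definition good_cover :: "'a::topological_space set set \<Rightarrow> bool" where
  "good_cover \<U> \<longleftrightarrow> (\<forall>\<V>. \<V> \<subseteq> \<U> \<and> finite \<V> \<and> \<V> \<noteq> {} \<longrightarrow>
      \<Inter>\<V> = {} \<or> contractible_space (top_of_set (\<Inter>\<V>)))"

end

theory Submission
  imports Defs
begin

text \<open>Take for \<open>C\<close> a countable dense subset of \<open>X\<close>. By the hypothesis on \<open>\<U>\<close>, \<open>Rips C r\<close> consists of
  the finite subsets of \<open>C\<close> contained in a member of \<open>\<U>\<close>; by Dowker duality it is homotopy
  equivalent to the complex of finite subsets of \<open>\<U>\<close> whose intersection meets \<open>C\<close>. Finite intersections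
  are open and \<open>C\<close> is dense, so this is the nerve of \<open>\<U>\<close>, which is homotopy equivalent to \<open>X\<close> by the
  nerve theorem. Both equivalences are given by explicit formulas in terms of the superlevel
  sets of barycentric coordinates, which play the role of a barycentric subdivision.\<close>

section \<open>Weak realizations of simplicial complexes\<close>

text \<open>The nerve of an infinite cover need not be locally finite, so its weak realization need
  not be metrizable and coordinatewise continuity into it is not enough. Supports are therefore kept
  in one finite vertex set: over each closed simplex for maps between complexes, and over all of
  \<open>X\<close> by compactness, through a partition of unity with finitely many members. The
  obstacle for both equivalences is that a round trip need not send \<open>p\<close> into a simplex
  shared with \<open>p\<close>, because a superlevel set may be smaller than the support. Once
  levels are cut at half of the largest coordinate, every superlevel set that counts contains the
  support of \<open>chop p\<close>. So the round trip shares a simplex with \<open>chop p\<close>,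
  and \<open>chop p\<close> shares one with \<open>p\<close>: two straight-line homotopies suffice.
  In the nerve theorem one construction serves twice. Run to time 1, the flow along the superlevel
  sets defines the map from the nerve to \<open>X\<close>; its earlier times, with parameter
  \<open>\<phi> x\<close> and starting point \<open>x\<close>, form the homotopy from the identity
  to the round trip on \<open>X\<close>. No induction over skeleta is needed.\<close>

definition simplicial :: "'a set set \<Rightarrow> bool" where
  "simplicial K \<longleftrightarrow> (\<forall>\<sigma>\<in>K. finite \<sigma> \<and> \<sigma> \<noteq> {} \<and> (\<forall>\<tau>. \<tau> \<subseteq> \<sigma> \<and> \<tau> \<noteq> {} \<longrightarrow> \<tau> \<in> K))"

lemma simplicialD:
  assumes "simplicial K" "\<sigma> \<in> K"
  shows "finite \<sigma>" "\<sigma> \<noteq> {}" "\<tau> \<subseteq> \<sigma> \<Longrightarrow> \<tau> \<noteq> {} \<Longrightarrow> \<tau> \<in> K"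
  using assms unfolding simplicial_def by blast+

definition supp :: "('a \<Rightarrow> real) \<Rightarrow> 'a set" where
  "supp p = {x. p x \<noteq> 0}"

lemma openin_weak_realization:
  "openin (weak_realization K) U \<longleftrightarrow> U \<subseteq> realization_carrier K \<and>
     (\<forall>\<sigma>\<in>K. openin (top_of_set (simplex_pts \<sigma>)) (U \<inter> simplex_pts \<sigma>))"
proof -
  have "istopology (\<lambda>U. U \<subseteq> realization_carrier K \<and>
     (\<forall>\<sigma>\<in>K. openin (top_of_set (simplex_pts \<sigma>)) (U \<inter> simplex_pts \<sigma>)))"
    unfolding istopology_def
  proof (rule conjI; intro allI impI conjI ballI)
    fix S T \<sigma>
    assume "S \<subseteq> realization_carrier K \<and> (\<forall>\<sigma>\<in>K. openin (top_of_set (simplex_pts \<sigma>)) (S \<inter> simplex_pts \<sigma>))"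
      "T \<subseteq> realization_carrier K \<and> (\<forall>\<sigma>\<in>K. openin (top_of_set (simplex_pts \<sigma>)) (T \<inter> simplex_pts \<sigma>))"
      "\<sigma> \<in> K"
    then have "openin (top_of_set (simplex_pts \<sigma>)) ((S \<inter> simplex_pts \<sigma>) \<inter> (T \<inter> simplex_pts \<sigma>))"
      by blast
    then show "openin (top_of_set (simplex_pts \<sigma>)) (S \<inter> T \<inter> simplex_pts \<sigma>)"
      by (simp add: Int_ac)
  next
    fix \<K> \<sigma>
    assume *: "\<forall>S\<in>\<K>. S \<subseteq> realization_carrier K \<and> (\<forall>\<sigma>\<in>K. openin (top_of_set (simplex_pts \<sigma>)) (S \<inter> simplex_pts \<sigma>))"
      and "\<sigma> \<in> K"
    then have "openin (top_of_set (simplex_pts \<sigma>)) (\<Union>S\<in>\<K>. S \<inter> simplex_pts \<sigma>)"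
      by blast
    then show "openin (top_of_set (simplex_pts \<sigma>)) (\<Union>\<K> \<inter> simplex_pts \<sigma>)"
      by (simp add: Int_commute Int_Union)
  qed blast+
  then show ?thesis
    unfolding weak_realization_def by (simp add: topology_inverse')
qed

lemma simplex_pts_subset_carrier: "\<sigma> \<in> K \<Longrightarrow> simplex_pts \<sigma> \<subseteq> realization_carrier K"
  by (auto simp: realization_carrier_def)

lemma topspace_weak_realization [simp]: "topspace (weak_realization K) = realization_carrier K"
proof (rule antisym)
  show "topspace (weak_realization K) \<subseteq> realization_carrier K"
    using openin_topspace[of "weak_realization K"] unfolding openin_weak_realization by blast
  have "openin (weak_realization K) (realization_carrier K)"
    by (simp add: openin_weak_realization simplex_pts_subset_carrier Int_absorb1)
  then show "realization_carrier K \<subseteq> topspace (weak_realization K)"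
    by (rule openin_subset)
qed

lemma closedin_weak_realization:
  "closedin (weak_realization K) A \<longleftrightarrow> A \<subseteq> realization_carrier K \<and>
     (\<forall>\<sigma>\<in>K. closedin (top_of_set (simplex_pts \<sigma>)) (A \<inter> simplex_pts \<sigma>))"
proof -
  have "(realization_carrier K - A) \<inter> simplex_pts \<sigma> = simplex_pts \<sigma> - A \<inter> simplex_pts \<sigma>" if "\<sigma> \<in> K" for \<sigma>
    using simplex_pts_subset_carrier[OF that] by blast
  then show ?thesis
    by (auto simp: closedin_def openin_weak_realization)
qed

section \<open>Continuous maps out of a weak realization and into it\<close>

lemma continuous_map_weak_realization:
  assumes "\<And>\<sigma>. \<sigma> \<in> K \<Longrightarrow> continuous_map (top_of_set (simplex_pts \<sigma>)) Y h"
  shows "continuous_map (weak_realization K) Y h"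
  unfolding continuous_map_def
proof (intro conjI allI impI)
  show "h \<in> topspace (weak_realization K) \<rightarrow> topspace Y"
    using assms by (fastforce simp: realization_carrier_def continuous_map_def)
  fix U assume U: "openin Y U"
  have "openin (top_of_set (simplex_pts \<sigma>)) ({x \<in> realization_carrier K. h x \<in> U} \<inter> simplex_pts \<sigma>)"
    if "\<sigma> \<in> K" for \<sigma>
  proof -
    have "{x \<in> realization_carrier K. h x \<in> U} \<inter> simplex_pts \<sigma> = {x \<in> simplex_pts \<sigma>. h x \<in> U}"
      using simplex_pts_subset_carrier[OF that] by blast
    then show ?thesis
      using openin_continuous_map_preimage[OF assms[OF that] U] by simp
  qed
  then show "openin (weak_realization K) {x \<in> topspace (weak_realization K). h x \<in> U}"
    by (auto simp: openin_weak_realization)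
qed

text \<open>The product of a weak realization with the compact interval again has the weak topology,
  by the tube lemma.\<close>

lemma continuous_map_prod_weak_realization:
  assumes "\<And>\<sigma>. \<sigma> \<in> K \<Longrightarrow>
    continuous_map (prod_topology (top_of_set {0..1::real}) (top_of_set (simplex_pts \<sigma>))) Y h"
  shows "continuous_map (prod_topology (top_of_set {0..1::real}) (weak_realization K)) Y h"
  unfolding continuous_map_def
proof (intro conjI allI impI)
  let ?I = "top_of_set {0..1::real}"
  have into: "h (t, x) \<in> topspace Y" if "t \<in> {0..1}" "x \<in> simplex_pts \<sigma>" "\<sigma> \<in> K" for t x \<sigma>
    using continuous_map_funspace[OF assms[OF that(3)]] that by auto
  then show "h \<in> topspace (prod_topology ?I (weak_realization K)) \<rightarrow> topspace Y"
    by (auto simp: realization_carrier_def)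
  fix U assume U: "openin Y U"
  define W where "W = {z \<in> {0..1} \<times> realization_carrier K. h z \<in> U}"
  have "\<exists>A B. openin ?I A \<and> openin (weak_realization K) B \<and> t \<in> A \<and> x \<in> B \<and> A \<times> B \<subseteq> W"
    if tx: "(t, x) \<in> W" for t x
  proof -
    obtain \<sigma> where \<sigma>: "\<sigma> \<in> K" "x \<in> simplex_pts \<sigma>" and t: "t \<in> {0..1}" and hU: "h (t, x) \<in> U"
      using tx by (auto simp: W_def realization_carrier_def)
    have slice: "openin (prod_topology ?I (top_of_set (simplex_pts \<tau>)))
        {z \<in> {0..1} \<times> simplex_pts \<tau>. h z \<in> U}" if "\<tau> \<in> K" for \<tau>
      using openin_continuous_map_preimage[OF assms[OF that] U] by simp
    obtain A0 where A0: "openin ?I A0" "t \<in> A0" "A0 \<times> {x} \<subseteq> W"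
    proof -
      obtain A B where "openin ?I A" "openin (top_of_set (simplex_pts \<sigma>)) B" "t \<in> A" "x \<in> B"
        "A \<times> B \<subseteq> {z \<in> {0..1} \<times> simplex_pts \<sigma>. h z \<in> U}"
        using slice[OF \<sigma>(1)] t \<sigma>(2) hU unfolding openin_prod_topology_alt
        by (elim allE[of _ t] allE[of _ x] impE) blast+
      then show ?thesis
        using simplex_pts_subset_carrier[OF \<sigma>(1)] that[of A] \<sigma>(2) by (fastforce simp: W_def)
    qed
    obtain e where e: "e > 0" "cball t e \<inter> {0..1} \<subseteq> A0"
      using A0(1,2) by (meson openin_contains_cball)
    define J where "J = cball t e \<inter> {0..1}"
    have "compact J"
      unfolding J_def by (simp add: compact_Int_closed)
    have J01: "J \<subseteq> {0..1}" "t \<in> J"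
      using e t by (auto simp: J_def)
    \<comment> \<open>\<open>A0\<close> is replaced by the compact \<open>J\<close> so that the tube
      lemma applies in every simplex of \<open>K\<close>, not only in the one chosen for
      \<open>x\<close>; openness of \<open>B\<close> in the weak topology asks for all of
      them.\<close>
    define B where "B = {y \<in> realization_carrier K. J \<times> {y} \<subseteq> W}"
    have "openin (weak_realization K) B"
      unfolding openin_weak_realization
    proof (intro conjI ballI)
      show "B \<subseteq> realization_carrier K" by (auto simp: B_def)
      fix \<tau> assume \<tau>: "\<tau> \<in> K"
      show "openin (top_of_set (simplex_pts \<tau>)) (B \<inter> simplex_pts \<tau>)"
      proof (subst openin_subopen, intro ballI)
        fix y assume y: "y \<in> B \<inter> simplex_pts \<tau>"
        have "compactin ?I J"
          using \<open>compact J\<close> J01 by (simp add: compactin_subtopology)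
        then obtain A' B' where AB: "openin ?I A'" "openin (top_of_set (simplex_pts \<tau>)) B'" "J \<subseteq> A'" "y \<in> B'"
           "A' \<times> B' \<subseteq> {z \<in> {0..1} \<times> simplex_pts \<tau>. h z \<in> U}"
        proof -
          have "J \<times> {y} \<subseteq> {z \<in> {0..1} \<times> simplex_pts \<tau>. h z \<in> U}"
            using y J01 by (auto simp: B_def W_def)
          then show ?thesis
            using tube_lemma_left[OF slice[OF \<tau>] \<open>compactin ?I J\<close>, of y] y that by auto
        qed
        have "B' \<subseteq> B \<inter> simplex_pts \<tau>"
          using AB simplex_pts_subset_carrier[OF \<tau>] J01 openin_imp_subset[OF AB(2)]
          unfolding B_def W_def by blast
        then show "\<exists>T. openin (top_of_set (simplex_pts \<tau>)) T \<and> y \<in> T \<and> T \<subseteq> B \<inter> simplex_pts \<tau>"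
          using AB by blast
      qed
    qed
    moreover have "x \<in> B"
      using A0 e \<sigma> simplex_pts_subset_carrier[OF \<sigma>(1)] by (auto simp: B_def J_def)
    moreover have "openin ?I (ball t e \<inter> {0..1})"
      by (metis inf_commute open_ball openin_open_Int)
    moreover have "(ball t e \<inter> {0..1}) \<times> B \<subseteq> W"
      by (auto simp: B_def J_def subset_iff)
    ultimately show ?thesis
      using t e(1) by (intro exI[of _ "ball t e \<inter> {0..1}"] exI[of _ B]) auto
  qed
  then have "openin (prod_topology ?I (weak_realization K)) W"
    unfolding openin_prod_topology_alt by blast
  then show "openin (prod_topology ?I (weak_realization K))
      {z \<in> topspace (prod_topology ?I (weak_realization K)). h z \<in> U}"
    by (simp add: W_def)
qed

lemma continuous_on_coordinate: "continuous_on S (\<lambda>p::'a \<Rightarrow> real. p x)"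
  by (rule continuous_on_subset[OF continuous_on_product_coordinates]) simp

lemma continuous_map_weak_realization_coordinate:
  "continuous_map (weak_realization K) euclideanreal (\<lambda>p. p x)"
  by (rule continuous_map_weak_realization) (simp add: continuous_on_coordinate)

lemma simplex_ptsD:
  assumes "p \<in> simplex_pts \<sigma>"
  shows "0 \<le> p x" "supp p \<subseteq> \<sigma>" "x \<notin> \<sigma> \<Longrightarrow> p x = 0" "sum p \<sigma> = 1"
  using assms by (auto simp: simplex_pts_def supp_def)

lemma supp_nonempty: "p \<in> simplex_pts \<sigma> \<Longrightarrow> supp p \<noteq> {}"
  unfolding simplex_pts_def supp_def
  by (smt (verit) empty_iff mem_Collect_eq sum.neutral)

lemma simplex_pts_mono:
  assumes "p \<in> simplex_pts \<sigma>" "finite \<tau>" "supp p \<subseteq> \<tau>" "finite \<sigma>"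
  shows "p \<in> simplex_pts \<tau>"
proof -
  have "sum p \<tau> = sum p (supp p)"
    using assms by (intro sum.mono_neutral_right) (auto simp: supp_def)
  also have "\<dots> = sum p \<sigma>"
    using assms simplex_ptsD(2)[OF assms(1)] by (intro sum.mono_neutral_left) (auto simp: supp_def)
  finally show ?thesis
    using assms by (auto simp: simplex_pts_def supp_def)
qed

lemma closed_simplex_pts: "closed (simplex_pts \<sigma>)"
proof -
  have "closed ((\<Inter>x\<in>-\<sigma>. {f. f x = 0}) \<inter> (\<Inter>x. {f. 0 \<le> f x}) \<inter> {f::'a\<Rightarrow>real. sum f \<sigma> = 1})"
    by (intro closed_Int closed_INT ballI closed_Collect_eq closed_Collect_le continuous_intros
        continuous_on_product_coordinates)
  also have "(\<Inter>x\<in>-\<sigma>. {f. f x = 0}) \<inter> (\<Inter>x. {f. 0 \<le> f x}) \<inter> {f::'a\<Rightarrow>real. sum f \<sigma> = 1} = simplex_pts \<sigma>"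
    by (auto simp: simplex_pts_def)
  finally show ?thesis .
qed

lemma simplicial_carrierD:
  assumes "simplicial K" "p \<in> realization_carrier K"
  shows "supp p \<in> K" "finite (supp p)" "p \<in> simplex_pts (supp p)" "0 \<le> p x"
proof -
  obtain \<sigma> where \<sigma>: "\<sigma> \<in> K" "p \<in> simplex_pts \<sigma>"
    using assms by (auto simp: realization_carrier_def)
  then have fin: "finite \<sigma>" and sub: "\<And>\<tau>. \<tau> \<subseteq> \<sigma> \<Longrightarrow> \<tau> \<noteq> {} \<Longrightarrow> \<tau> \<in> K"
    using simplicialD[OF assms(1)] by blast+
  show "supp p \<in> K"
    by (intro sub simplex_ptsD(2)[OF \<sigma>(2)] supp_nonempty[OF \<sigma>(2)])
  show "finite (supp p)"
    by (rule finite_subset[OF simplex_ptsD(2)[OF \<sigma>(2)] fin])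
  then show "p \<in> simplex_pts (supp p)"
    using simplex_pts_mono \<sigma> fin by blast
  show "0 \<le> p x"
    by (rule simplex_ptsD(1)[OF \<sigma>(2)])
qed

lemma carrierI: "\<sigma> \<in> K \<Longrightarrow> p \<in> simplex_pts \<sigma> \<Longrightarrow> p \<in> realization_carrier K"
  by (auto simp: realization_carrier_def)

text \<open>The weak topology is finer than the one of coordinates, but the two agree where only
  finitely many vertices occur: if all supports lie in \<open>F\<close>, the preimage of a closed
  set is the union of its preimages over the finitely many simplices inside \<open>F\<close>, and
  each of these is closed for the product topology.\<close>

lemma continuous_map_into_weak_realization:
  assumes K: "simplicial K" and into: "\<And>z. z \<in> topspace Z \<Longrightarrow> h z \<in> realization_carrier K"
    and cont: "\<And>x. continuous_map Z euclideanreal (\<lambda>z. h z x)"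
    and F: "finite F" "\<And>z. z \<in> topspace Z \<Longrightarrow> supp (h z) \<subseteq> F"
  shows "continuous_map Z (weak_realization K) h"
  unfolding continuous_map_closedin
proof (intro conjI allI impI)
  show "h \<in> topspace Z \<rightarrow> topspace (weak_realization K)" using into by simp
next
  fix A assume A: "closedin (weak_realization K) A"
  have h: "continuous_map Z euclidean h"
    using cont by (simp add: continuous_map_componentwise_UNIV flip: euclidean_product_topology)
  have "closedin Z {z \<in> topspace Z. h z \<in> A \<inter> simplex_pts \<sigma>}" if "\<sigma> \<in> K" for \<sigma>
  proof -
    have "closed (A \<inter> simplex_pts \<sigma>)"
      using A that closed_simplex_pts[of \<sigma>] closedin_closed_trans by (auto simp: closedin_weak_realization)
    then show ?thesis
      by (intro closedin_continuous_map_preimage[OF h]) (simp flip: closed_closedin)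
  qed
  then have "closedin Z (\<Union>\<sigma>\<in>{\<sigma>\<in>K. \<sigma> \<subseteq> F}. {z \<in> topspace Z. h z \<in> A \<inter> simplex_pts \<sigma>})"
    using F(1) by (intro closedin_Union) auto
  also have "(\<Union>\<sigma>\<in>{\<sigma>\<in>K. \<sigma> \<subseteq> F}. {z \<in> topspace Z. h z \<in> A \<inter> simplex_pts \<sigma>}) = {z \<in> topspace Z. h z \<in> A}"
    using simplicial_carrierD(1,3)[OF K into] F(2) by fastforce
  finally show "closedin Z {z \<in> topspace Z. h z \<in> A}" .
qed

text \<open>Straight-line homotopy. \<open>near\<close> keeps each segment inside one closed simplex
  of \<open>L\<close>; \<open>fin\<close> bounds the vertices used over a closed simplex of
  \<open>K\<close>, which turns coordinatewise continuity into continuity for the weak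
  topology.\<close>

lemma homotopic_linear:
  assumes K: "simplicial K" and L: "simplicial L"
    and f: "continuous_map (weak_realization K) (weak_realization L) f"
    and g: "continuous_map (weak_realization K) (weak_realization L) g"
    and near: "\<And>p. p \<in> realization_carrier K \<Longrightarrow> supp (f p) \<union> supp (g p) \<in> L"
    and fin: "\<And>\<sigma>. \<sigma> \<in> K \<Longrightarrow> \<exists>F. finite F \<and> (\<forall>p\<in>simplex_pts \<sigma>. supp (f p) \<subseteq> F \<and> supp (g p) \<subseteq> F)"
  shows "homotopic_with (\<lambda>_. True) (weak_realization K) (weak_realization L) f g"
proof -
  define h where "h = (\<lambda>(t::real, p) x. (1 - t) * f p x + t * g p x)"
  have "continuous_map (prod_topology (top_of_set {0..1::real}) (weak_realization K)) (weak_realization L) h"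
  proof (rule continuous_map_prod_weak_realization)
    fix \<sigma> assume \<sigma>: "\<sigma> \<in> K"
    let ?Z = "prod_topology (top_of_set {0..1::real}) (top_of_set (simplex_pts \<sigma>))"
    obtain F where F: "finite F" "\<And>p. p \<in> simplex_pts \<sigma> \<Longrightarrow> supp (f p) \<subseteq> F \<and> supp (g p) \<subseteq> F"
      using fin[OF \<sigma>] by blast
    have coord: "continuous_map (top_of_set (simplex_pts \<sigma>)) euclideanreal (\<lambda>p. k p x)"
      if "continuous_map (weak_realization K) (weak_realization L) k" for k x
    proof -
      have "continuous_map (top_of_set (simplex_pts \<sigma>)) (weak_realization K) id"
      proof (rule continuous_map_into_weak_realization[OF K, where F = \<sigma>])
        show "finite \<sigma>" using K \<sigma> by (simp add: simplicial_def)
        show "id z \<in> realization_carrier K" if "z \<in> topspace (top_of_set (simplex_pts \<sigma>))" for z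
          using that carrierI[OF \<sigma>] by simp
        show "supp (id z) \<subseteq> \<sigma>" if "z \<in> topspace (top_of_set (simplex_pts \<sigma>))" for z
          using that simplex_ptsD(2) by simp
        show "continuous_map (top_of_set (simplex_pts \<sigma>)) euclideanreal (\<lambda>z. id z x)" for x
          by (simp add: continuous_on_coordinate)
      qed
      from continuous_map_compose[OF continuous_map_compose[OF this that] 
          continuous_map_weak_realization_coordinate[of L x]]
      show ?thesis by (simp add: o_def)
    qed
    show "continuous_map ?Z (weak_realization L) h"
    proof (rule continuous_map_into_weak_realization[OF L _ _ F(1)])
      fix z assume "z \<in> topspace ?Z"
      then obtain t p where z: "z = (t, p)" "t \<in> {0..1}" "p \<in> simplex_pts \<sigma>" by auto
      then have p: "p \<in> realization_carrier K" using carrierI \<sigma> by blast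
      then have fp: "f p \<in> realization_carrier L" and gp: "g p \<in> realization_carrier L"
        using continuous_map_funspace[OF f] continuous_map_funspace[OF g] by auto
      let ?\<tau> = "supp (f p) \<union> supp (g p)"
      have "finite ?\<tau>" using near[OF p] L simplicialD by blast
      then have "f p \<in> simplex_pts ?\<tau>" "g p \<in> simplex_pts ?\<tau>"
        using simplex_pts_mono[OF simplicial_carrierD(3)[OF L fp]  _ _ simplicial_carrierD(2)[OF L fp]]
          simplex_pts_mono[OF simplicial_carrierD(3)[OF L gp]  _ _ simplicial_carrierD(2)[OF L gp]] by blast+
      note fgp = this
      have "h (t, p) \<in> simplex_pts ?\<tau>"
        unfolding simplex_pts_def
      proof (intro CollectI conjI allI impI)
        show "h (t, p) x = 0" if "x \<notin> ?\<tau>" for x using that by (simp add: h_def supp_def)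
        show "0 \<le> h (t, p) x" for x
          using z(2) simplex_ptsD(1)[OF fgp(1)] simplex_ptsD(1)[OF fgp(2)] by (simp add: h_def)
        have "sum (h (t, p)) ?\<tau> = (1 - t) * sum (f p) ?\<tau> + t * sum (g p) ?\<tau>"
          unfolding h_def prod.case sum.distrib sum_distrib_left ..
        then show "sum (h (t, p)) ?\<tau> = 1"
          using simplex_ptsD(4)[OF fgp(1)] simplex_ptsD(4)[OF fgp(2)] by simp
      qed
      then show "h z \<in> realization_carrier L"
        using near[OF p] z carrierI by metis
      have "supp (h (t,p)) \<subseteq> ?\<tau>" by (auto simp: h_def supp_def)
      then show "supp (h z) \<subseteq> F" using F(2) z by blast
    next
      fix x
      have cf: "continuous_on (simplex_pts \<sigma>) (\<lambda>p. f p x)" and cg: "continuous_on (simplex_pts \<sigma>) (\<lambda>p. g p x)"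
        using coord[OF f] coord[OF g] by simp_all
      have "continuous_on ({0..1} \<times> simplex_pts \<sigma>) (\<lambda>z. (1 - fst z) * f (snd z) x + fst z * g (snd z) x)"
        by (intro continuous_intros continuous_on_compose2[OF cf] continuous_on_compose2[OF cg]) auto
      then show "continuous_map ?Z euclideanreal (\<lambda>z. h z x)"
        by (simp add: h_def case_prod_unfold)
    qed
  qed
  then show ?thesis
    unfolding homotopic_with_def by (intro exI[of _ h]) (simp add: h_def)
qed

section \<open>Superlevel sets of barycentric coordinates\<close>

text \<open>The inserted 0 keeps \<open>Max\<close> defined when the complement of \<open>V\<close>
  is empty, and is harmless because coordinates are nonnegative. The complement may be infinite, but
  finite support makes the image finite. For \<open>V = {}\<close> this is the largest
  coordinate.\<close>

definition outer_max :: "'a set \<Rightarrow> ('a \<Rightarrow> real) \<Rightarrow> real" where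
  "outer_max V p = Max (insert 0 (p ` (- V)))"

abbreviation peak :: "('a \<Rightarrow> real) \<Rightarrow> real" where
  "peak p \<equiv> outer_max {} p"

text \<open>For finite nonempty \<open>V\<close>, \<open>gap V p\<close> is the length of the set of levels in \<open>(0, peak p / 2]\<close>
  at which the superlevel set of \<open>p\<close> is \<open>V\<close>. So the sets of positive gap form a chain; the cut at
  half of the peak keeps them from shrinking below the support of \<open>chop p\<close>.\<close>

definition gap :: "'a set \<Rightarrow> ('a \<Rightarrow> real) \<Rightarrow> real" where
  "gap V p = max 0 (Min (insert (peak p / 2) (p ` V)) - outer_max V p)"

lemma finite_image_supp: "finite (supp p) \<Longrightarrow> finite (p ` A)"
  by (rule finite_subset[of _ "insert 0 (p ` supp p)"]) (auto simp: supp_def)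

lemma outer_max_eq:
  assumes "supp p \<subseteq> F"
  shows "outer_max V p = Max (insert 0 (p ` (F - V)))"
proof -
  have "insert 0 (p ` (- V)) = insert 0 (p ` (F - V))"
    using assms by (auto simp: supp_def)
  then show ?thesis by (simp add: outer_max_def)
qed

lemma outer_max_ge: "finite (supp p) \<Longrightarrow> x \<notin> V \<Longrightarrow> p x \<le> outer_max V p"
  by (simp add: outer_max_def finite_image_supp)

lemma outer_max_nonneg: "finite (supp p) \<Longrightarrow> 0 \<le> outer_max V p"
  by (simp add: outer_max_def finite_image_supp)

lemma outer_max_less: "finite (supp p) \<Longrightarrow> 0 < c \<Longrightarrow> (\<And>x. x \<notin> V \<Longrightarrow> p x < c) \<Longrightarrow> outer_max V p < c"
  by (auto simp: outer_max_def finite_image_supp)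

lemma gap_nonneg [simp]: "0 \<le> gap V p"
  by (simp add: gap_def)

lemma gap_pos_iff:
  assumes "finite V"
  shows "0 < gap V p \<longleftrightarrow> outer_max V p < peak p / 2 \<and> (\<forall>x\<in>V. outer_max V p < p x)"
  using assms by (simp add: gap_def less_max_iff_disj)

text \<open>Coordinates outside \<open>V\<close> are at most \<open>outer_max V p\<close>, hence
  below half of the peak. So all sets of positive gap share the vertices of coordinate at least
  \<open>peak p / 2\<close>; every later comparison rests on this common core.\<close>

lemma gap_pos_ge_peak: "finite (supp p) \<Longrightarrow> finite V \<Longrightarrow> 0 < gap V p \<Longrightarrow> peak p / 2 \<le> p x \<Longrightarrow> x \<in> V"
  using outer_max_ge[of p x V] by (force simp: gap_pos_iff)

lemma gap_pos_subset_supp: "finite (supp p) \<Longrightarrow> finite V \<Longrightarrow> 0 < gap V p \<Longrightarrow> V \<subseteq> supp p"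
  using outer_max_nonneg[of p V] by (force simp: gap_pos_iff supp_def)

lemma gap_pos_superlevel:
  "finite (supp p) \<Longrightarrow> finite V \<Longrightarrow> 0 < gap V p \<Longrightarrow> x \<in> V \<Longrightarrow> y \<notin> V \<Longrightarrow> p y < p x"
  using outer_max_ge[of p y V] by (force simp: gap_pos_iff)

lemma peak_attained:
  assumes "finite (supp p)" "p x > 0"
  shows "0 < peak p" "\<exists>y. p y = peak p"
proof -
  show pos: "0 < peak p"
    using outer_max_ge[OF assms(1), of x "{}"] assms(2) by simp
  have "peak p \<in> insert 0 (p ` (- {}))"
    unfolding outer_max_def by (intro Max_in) (simp_all only: finite_insert finite_image_supp[OF assms(1)], simp)
  then consider "peak p = 0" | y where "peak p = p y" by blast
  then show "\<exists>y. p y = peak p"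
    by cases (use pos in auto)
qed

lemma gap_pos_nonempty:
  assumes "finite (supp p)" "finite V" "0 < gap V p" "p x > 0"
  shows "V \<noteq> {}"
proof -
  obtain y where "p y = peak p" "0 < peak p" using peak_attained[OF assms(1,4)] by blast
  then show ?thesis using gap_pos_ge_peak[OF assms(1-3), of y] by auto
qed

text \<open>The common core is itself a set of positive gap, the smallest one. Hence the chain is
  never empty, and the sums and maxima of gaps used as denominators are positive.\<close>

lemma gap_half_peak_pos:
  assumes "finite (supp p)" "p x > 0"
  shows "finite {x. peak p / 2 \<le> p x}" "0 < gap {x. peak p / 2 \<le> p x} p"
proof -
  have pos: "0 < peak p" by (rule peak_attained(1)[OF assms])
  show fin: "finite {x. peak p / 2 \<le> p x}"
    by (rule finite_subset[OF _ assms(1)]) (use pos in \<open>auto simp: supp_def\<close>)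
  have "outer_max {x. peak p / 2 \<le> p x} p < peak p / 2"
    using pos by (intro outer_max_less assms(1)) auto
  then show "0 < gap {x. peak p / 2 \<le> p x} p"
    using fin by (auto simp: gap_pos_iff)
qed

text \<open>Only weak inequalities are asked of \<open>W\<close>, so ties are allowed. Weak
  inequalities are closed conditions, which matters when maps are pasted along closed
  pieces.\<close>

lemma gap_pos_comparable:
  assumes "finite (supp p)" "finite V" "0 < gap V p" "\<And>x y. x \<in> W \<Longrightarrow> y \<notin> W \<Longrightarrow> p y \<le> p x"
  shows "V \<subseteq> W \<or> W \<subseteq> V"
  using gap_pos_superlevel[OF assms(1-3)] assms(4) by (meson linorder_not_le subsetI)

section \<open>Continuous dependence of gaps on the point\<close>

lemma continuous_on_Max_insert0:
  assumes "finite I" "\<And>i. i \<in> I \<Longrightarrow> continuous_on S (\<lambda>y. f y i)"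
  shows "continuous_on S (\<lambda>y. Max (insert 0 (f y ` I)) :: real)"
  using assms
proof (induction I)
  case (insert i I)
  have "Max (insert 0 (f y ` insert i I)) = max (f y i) (Max (insert 0 (f y ` I)))" for y
    using insert(1) by (simp add: insert_commute[of 0])
  then show ?case using insert by (auto intro!: continuous_on_max)
qed auto

lemma continuous_on_Min_insert:
  assumes "finite I" "\<And>i. i \<in> I \<Longrightarrow> continuous_on S (\<lambda>y. f y i)" "continuous_on S g"
  shows "continuous_on S (\<lambda>y. Min (insert (g y) (f y ` I)) :: real)"
  using assms
proof (induction I)
  case (insert i I)
  have "Min (insert (g y) (f y ` insert i I)) = min (f y i) (Min (insert (g y) (f y ` I)))" for y
    using insert(1) by (simp add: insert_commute[of "g y"])
  then show ?case using insert by (auto intro!: continuous_on_min)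
qed auto

lemma continuous_on_outer_max:
  assumes "finite F" "\<And>y. y \<in> Y \<Longrightarrow> supp (q y) \<subseteq> F" "\<And>x. continuous_on Y (\<lambda>y. q y x)"
  shows "continuous_on Y (\<lambda>y. outer_max V (q y))"
proof -
  have "continuous_on Y (\<lambda>y. Max (insert 0 (q y ` (F - V))))"
    using assms by (intro continuous_on_Max_insert0) auto
  then show ?thesis
    by (rule continuous_on_eq) (simp add: outer_max_eq[OF assms(2)])
qed

lemma continuous_on_gap:
  assumes "finite F" "\<And>y. y \<in> Y \<Longrightarrow> supp (q y) \<subseteq> F" "\<And>x. continuous_on Y (\<lambda>y. q y x)" "finite V"
  shows "continuous_on Y (\<lambda>y. gap V (q y))"
  unfolding gap_def
  by (intro continuous_on_max continuous_on_diff continuous_on_const continuous_on_Min_insert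
      continuous_on_outer_max[OF assms(1-3)] continuous_on_divide assms) auto

text \<open>Up to the choice of coordinates, \<open>push c\<close> is the barycentric subdivision followed by the simplicial
  map that sends the vertex \<open>V\<close> to \<open>c V\<close>.\<close>

definition push :: "('a set \<Rightarrow> 'b) \<Rightarrow> ('a \<Rightarrow> real) \<Rightarrow> 'b \<Rightarrow> real" where
  "push c p b = (\<Sum>V\<in>Pow (supp p). if c V = b then gap V p else 0) / (\<Sum>V\<in>Pow (supp p). gap V p)"

text \<open>Substitute for the identity in comparisons: it moves \<open>p\<close> within its own
  face to a point supported on the common core of the sets of positive gap.\<close>

definition chop :: "('a \<Rightarrow> real) \<Rightarrow> 'a \<Rightarrow> real" where
  "chop p x = max 0 (p x - peak p / 2) / (\<Sum>y\<in>supp p. max 0 (p y - peak p / 2))"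

context
  fixes p :: "'a \<Rightarrow> real" and \<sigma> :: "'a set"
  assumes p: "p \<in> simplex_pts \<sigma>" and \<sigma>: "finite \<sigma>"
begin

lemma simplex_pts_finite_supp: "finite (supp p)"
  using finite_subset simplex_ptsD(2)[OF p] \<sigma> by blast

lemma simplex_pts_pos: "\<exists>x. p x > 0"
  using supp_nonempty[OF p] simplex_ptsD(1)[OF p] by (force simp: supp_def less_le)

lemma sum_gap_pos: "0 < (\<Sum>V\<in>Pow (supp p). gap V p)"
proof -
  obtain x where x: "p x > 0" using simplex_pts_pos by blast
  note half = gap_half_peak_pos[OF simplex_pts_finite_supp x]
  show ?thesis
    using gap_pos_subset_supp[OF simplex_pts_finite_supp half] simplex_pts_finite_supp half(2)
    by (intro sum_pos2[where i = "{x. peak p / 2 \<le> p x}"]) auto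
qed

lemma sum_chop_pos: "0 < (\<Sum>y\<in>supp p. max 0 (p y - peak p / 2))"
proof -
  obtain y where y: "p y = peak p" "0 < peak p"
    using simplex_pts_pos peak_attained[OF simplex_pts_finite_supp] by metis
  then show ?thesis
    using simplex_pts_finite_supp by (intro sum_pos2[where i = y]) (auto simp: supp_def)
qed

lemma supp_push_subset: "supp (push c p) \<subseteq> c ` {V. V \<subseteq> supp p \<and> 0 < gap V p}"
proof
  fix b assume "b \<in> supp (push c p)"
  then have "(\<Sum>V\<in>Pow (supp p). if c V = b then gap V p else 0) \<noteq> 0"
    by (auto simp: supp_def push_def)
  then obtain V where "V \<in> Pow (supp p)" "(if c V = b then gap V p else 0) \<noteq> 0"
    by (rule sum.not_neutral_contains_not_neutral)
  then show "b \<in> c ` {V. V \<subseteq> supp p \<and> 0 < gap V p}"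
    by (auto split: if_splits simp: less_le)
qed

lemma push_simplex: "push c p \<in> simplex_pts (c ` {V. V \<subseteq> supp p \<and> 0 < gap V p})"
proof -
  let ?T = "c ` {V. V \<subseteq> supp p \<and> 0 < gap V p}" and ?P = "Pow (supp p)"
  have "(\<Sum>b\<in>?T. \<Sum>V\<in>?P. if c V = b then gap V p else 0) = (\<Sum>V\<in>?P. \<Sum>b\<in>?T. if c V = b then gap V p else 0)"
    by (rule sum.swap)
  also have "\<dots> = (\<Sum>V\<in>?P. gap V p)"
  proof (rule sum.cong)
    fix V assume "V \<in> ?P"
    then show "(\<Sum>b\<in>?T. if c V = b then gap V p else 0) = gap V p"
      using simplex_pts_finite_supp gap_nonneg[of V p] by (auto simp: less_le)
  qed simp
  finally have "sum (push c p) ?T = 1"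
    using sum_gap_pos by (simp add: push_def flip: sum_divide_distrib)
  moreover have "0 \<le> push c p b" for b
    unfolding push_def by (intro divide_nonneg_nonneg sum_nonneg) auto
  ultimately show ?thesis
    using supp_push_subset[of c] unfolding simplex_pts_def supp_def by blast
qed

lemma supp_chop_subset: "supp (chop p) \<subseteq> {x. peak p / 2 \<le> p x}" "supp (chop p) \<subseteq> supp p"
  using outer_max_nonneg[OF simplex_pts_finite_supp, of "{}"] by (auto simp: supp_def chop_def)

lemma chop_simplex: "chop p \<in> simplex_pts (supp p)"
proof -
  have "sum (chop p) (supp p) = 1"
    using sum_chop_pos by (simp add: chop_def flip: sum_divide_distrib)
  moreover have "0 \<le> chop p b" for b
    unfolding chop_def by (intro divide_nonneg_nonneg sum_nonneg) auto
  ultimately show ?thesis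
    using supp_chop_subset(2) by (auto simp: simplex_pts_def supp_def)
qed

end

lemma continuous_on_push:
  assumes F: "finite F"
  shows "continuous_on (simplex_pts F) (\<lambda>p. push c p b)"
proof -
  \<comment> \<open>The index set \<open>Pow (supp p)\<close> jumps as \<open>p\<close> moves.
    Subsets of \<open>F\<close> not contained in the support have gap 0, so both sums may run over
    the fixed set \<open>Pow F\<close>.\<close>
  have "(\<Sum>V\<in>Pow (supp p). gap V p) = (\<Sum>V\<in>Pow F. gap V p) \<and>
    (\<Sum>V\<in>Pow (supp p). if c V = b then gap V p else 0) = (\<Sum>V\<in>Pow F. if c V = b then gap V p else 0)"
    if p: "p \<in> simplex_pts F" for p
  proof -
    have "gap V p = 0" if "V \<subseteq> F" "\<not> V \<subseteq> supp p" for V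
      using gap_pos_subset_supp[OF simplex_pts_finite_supp[OF p F], of V] gap_nonneg[of V p] that F
        finite_subset[of V F] by (auto simp: less_le)
    then show ?thesis
      using simplex_ptsD(2)[OF p] F by (intro conjI sum.mono_neutral_left) auto
  qed note eq = this
  have "continuous_on (simplex_pts F)
     (\<lambda>p. (\<Sum>V\<in>Pow F. if c V = b then gap V p else 0) / (\<Sum>V\<in>Pow F. gap V p))"
  proof (intro continuous_on_divide continuous_on_sum ballI)
    have g: "continuous_on (simplex_pts F) (gap V)" if "V \<in> Pow F" for V
      using continuous_on_gap[of F "simplex_pts F" "\<lambda>p. p" V] simplex_ptsD(2) F that finite_subset
      by (force intro: continuous_on_coordinate)
    then show "continuous_on (simplex_pts F) (\<lambda>p. if c V = b then gap V p else 0)"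
      "continuous_on (simplex_pts F) (gap V)" if "V \<in> Pow F" for V
      using that by (cases "c V = b"; auto)+
    show "(\<Sum>V\<in>Pow F. gap V p) \<noteq> 0" if "p \<in> simplex_pts F" for p
      using sum_gap_pos[OF that F] eq[OF that] by simp
  qed
  then show ?thesis
    by (rule continuous_on_eq) (simp add: eq push_def)
qed

lemma continuous_on_chop:
  assumes F: "finite F"
  shows "continuous_on (simplex_pts F) (\<lambda>p. chop p x)"
proof -
  have eq: "(\<Sum>y\<in>supp p. max 0 (p y - peak p / 2)) = (\<Sum>y\<in>F. max 0 (p y - peak p / 2))"
    if p: "p \<in> simplex_pts F" for p
    using simplex_ptsD(2)[OF p] F outer_max_nonneg[OF simplex_pts_finite_supp[OF p F], of "{}"]
    by (intro sum.mono_neutral_left) (auto simp: supp_def)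
  have "continuous_on (simplex_pts F) (\<lambda>p. max 0 (p x - peak p / 2) / (\<Sum>y\<in>F. max 0 (p y - peak p / 2)))"
  proof (intro continuous_on_divide continuous_on_sum continuous_on_max continuous_on_diff
      continuous_on_const continuous_on_coordinate continuous_on_outer_max[OF F] ballI)
    show "(\<Sum>y\<in>F. max 0 (p y - peak p / 2)) \<noteq> 0" if "p \<in> simplex_pts F" for p
      using sum_chop_pos[OF that F] eq[OF that] by simp
  qed (auto dest: simplex_ptsD(2))
  then show ?thesis
    by (rule continuous_on_eq) (simp add: eq chop_def)
qed

section \<open>Dowker duality\<close>

definition dowker :: "'a set \<Rightarrow> 'b set \<Rightarrow> ('a \<Rightarrow> 'b \<Rightarrow> bool) \<Rightarrow> 'a set set" where
  "dowker A B R = {\<sigma>. finite \<sigma> \<and> \<sigma> \<noteq> {} \<and> \<sigma> \<subseteq> A \<and> (\<exists>b\<in>B. \<forall>a\<in>\<sigma>. R a b)}"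

lemma simplicial_dowker: "simplicial (dowker A B R)"
  unfolding simplicial_def dowker_def by (blast intro: finite_subset)

lemma chop_homotopic_id:
  assumes K: "simplicial K"
  shows "homotopic_with (\<lambda>_. True) (weak_realization K) (weak_realization K) id chop"
proof (rule homotopic_linear[OF K K continuous_map_id])
  show "continuous_map (weak_realization K) (weak_realization K) chop"
  proof (rule continuous_map_weak_realization)
    fix \<sigma> assume \<sigma>: "\<sigma> \<in> K"
    note fin = simplicialD(1)[OF K \<sigma>]
    show "continuous_map (top_of_set (simplex_pts \<sigma>)) (weak_realization K) chop"
    proof (rule continuous_map_into_weak_realization[OF K, where F = \<sigma>])
      fix p assume "p \<in> topspace (top_of_set (simplex_pts \<sigma>))"
      then have p: "p \<in> simplex_pts \<sigma>" by simp
      show "chop p \<in> realization_carrier K"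
        using chop_simplex[OF p fin] simplicialD(3)[OF K \<sigma> simplex_ptsD(2)[OF p] supp_nonempty[OF p]] carrierI
        by blast
      show "supp (chop p) \<subseteq> \<sigma>"
        using supp_chop_subset(2)[OF p fin] simplex_ptsD(2)[OF p] by blast
    qed (use fin continuous_on_chop[OF fin] in auto)
  qed
next
  fix p assume p: "p \<in> realization_carrier K"
  have "supp (chop p) \<subseteq> supp p"
    by (rule supp_chop_subset(2)[OF simplicial_carrierD(3)[OF K p] simplicial_carrierD(2)[OF K p]])
  then show "supp (id p) \<union> supp (chop p) \<in> K"
    using simplicial_carrierD(1)[OF K p] by (simp add: Un_absorb2)
next
  fix \<sigma> assume \<sigma>: "\<sigma> \<in> K"
  note fin = simplicialD(1)[OF K \<sigma>]
  show "\<exists>F. finite F \<and> (\<forall>p\<in>simplex_pts \<sigma>. supp (id p) \<subseteq> F \<and> supp (chop p) \<subseteq> F)"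
    using fin supp_chop_subset(2)[OF _ fin] simplex_ptsD(2) by (intro exI[of _ \<sigma>]) fastforce
qed

text \<open>A vertex \<open>a\<close> of largest coordinate lies in every \<open>V\<close> of
  positive gap, so every \<open>c V\<close> is related to \<open>a\<close>; this \<open>a\<close> is
  the witness that the new vertices span a simplex of the dual complex.\<close>

lemma
  assumes c: "\<And>\<sigma>. \<sigma> \<in> dowker A B R \<Longrightarrow> c \<sigma> \<in> B \<and> (\<forall>a\<in>\<sigma>. R a (c \<sigma>))"
  shows push_dowker_carrier: "p \<in> realization_carrier (dowker A B R) \<Longrightarrow>
      push c p \<in> realization_carrier (dowker B A (\<lambda>b a. R a b))"
    and continuous_map_push_dowker:
      "continuous_map (weak_realization (dowker A B R)) (weak_realization (dowker B A (\<lambda>b a. R a b))) (push c)"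
proof -
  let ?K = "dowker A B R" and ?L = "dowker B A (\<lambda>b a. R a b)"
  have K: "simplicial ?K" and L: "simplicial ?L" by (rule simplicial_dowker)+
  show *: "push c p \<in> realization_carrier ?L" if p: "p \<in> realization_carrier ?K" for p
  proof -
    note pD = simplicial_carrierD[OF K p]
    obtain x where x: "p x > 0" using simplex_pts_pos[OF pD(3,2)] by blast
    obtain a where a: "p a = peak p" "0 < peak p" using peak_attained[OF pD(2) x] by auto
    let ?\<V> = "{V. V \<subseteq> supp p \<and> 0 < gap V p}"
    have V: "V \<in> ?K \<and> a \<in> V" if "V \<in> ?\<V>" for V
    proof -
      have fV: "finite V" using that pD(2) finite_subset by auto
      then have "a \<in> V" using gap_pos_ge_peak[OF pD(2) fV, of a] that a by auto
      then show ?thesis using simplicialD(3)[OF K pD(1), of V] that by auto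
    qed
    have "finite (c ` ?\<V>)" using pD(2) by simp
    moreover have "c ` ?\<V> \<noteq> {}"
      using simplex_ptsD(2)[OF push_simplex[OF pD(3,2), of c]] supp_nonempty[OF push_simplex[OF pD(3,2), of c]]
      by blast
    moreover have "a \<in> A" using pD(1) a by (auto simp: dowker_def supp_def)
    moreover have "c V \<in> B \<and> R a (c V)" if "V \<in> ?\<V>" for V
      using V[OF that] c by blast
    ultimately have "c ` ?\<V> \<in> ?L"
      unfolding dowker_def by auto
    then show ?thesis
      using push_simplex[OF pD(3,2)] carrierI by blast
  qed
  show "continuous_map (weak_realization ?K) (weak_realization ?L) (push c)"
  proof (rule continuous_map_weak_realization)
    fix \<sigma> assume \<sigma>: "\<sigma> \<in> ?K"
    note fin = simplicialD(1)[OF K \<sigma>]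
    show "continuous_map (top_of_set (simplex_pts \<sigma>)) (weak_realization ?L) (push c)"
    proof (rule continuous_map_into_weak_realization[OF L, where F = "c ` Pow \<sigma>"])
      fix p assume "p \<in> topspace (top_of_set (simplex_pts \<sigma>))"
      then have p: "p \<in> simplex_pts \<sigma>" by simp
      show "push c p \<in> realization_carrier ?L"
        using * carrierI[OF \<sigma> p] by blast
      show "supp (push c p) \<subseteq> c ` Pow \<sigma>"
        using supp_push_subset[OF p fin, of c] simplex_ptsD(2)[OF p] by blast
    qed (use fin continuous_on_push[OF fin] in auto)
  qed
qed

text \<open>The round trip is compared with \<open>chop\<close> rather than with the identity; one
  element \<open>b\<close> of \<open>B\<close> witnesses that both images of \<open>p\<close> lie in
  a common simplex.\<close>

lemma push_push_homotopic_id: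
  assumes c: "\<And>\<sigma>. \<sigma> \<in> dowker A B R \<Longrightarrow> c \<sigma> \<in> B \<and> (\<forall>a\<in>\<sigma>. R a (c \<sigma>))"
    and d: "\<And>\<tau>. \<tau> \<in> dowker B A (\<lambda>b a. R a b) \<Longrightarrow> d \<tau> \<in> A \<and> (\<forall>b\<in>\<tau>. R (d \<tau>) b)"
  shows "homotopic_with (\<lambda>_. True) (weak_realization (dowker A B R)) (weak_realization (dowker A B R))
    (push d \<circ> push c) id"
proof -
  let ?K = "dowker A B R" and ?L = "dowker B A (\<lambda>b a. R a b)"
  have K: "simplicial ?K" and L: "simplicial ?L" by (rule simplicial_dowker)+
  have "homotopic_with (\<lambda>_. True) (weak_realization ?K) (weak_realization ?K) chop (push d \<circ> push c)"
  proof (rule homotopic_linear[OF K K])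
    show "continuous_map (weak_realization ?K) (weak_realization ?K) chop"
      using homotopic_with_imp_continuous_maps[OF chop_homotopic_id[OF K]] by blast
    show "continuous_map (weak_realization ?K) (weak_realization ?K) (push d \<circ> push c)"
      using continuous_map_compose[OF continuous_map_push_dowker[of A B R c, OF c]
          continuous_map_push_dowker[of B A "\<lambda>b a. R a b" d, OF d]] by simp
  next
    fix p assume p: "p \<in> realization_carrier ?K"
    note pD = simplicial_carrierD[OF K p]
    let ?q = "push c p"
    have q: "?q \<in> realization_carrier ?L" using push_dowker_carrier[of A B R c, OF c p] by simp
    note qD = simplicial_carrierD[OF L q]
    obtain x where x: "?q x > 0" using simplex_pts_pos[OF qD(3,2)] by blast
    \<comment> \<open>The vertex \<open>b\<close> of largest coordinate in \<open>push c p\<close>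
      has the form \<open>c V\<close>, so it is related to all of \<open>V\<close>, which contains
      the support of \<open>chop p\<close>. It also lies in every \<open>W\<close> of positive gap
      for \<open>push c p\<close>, so it is related to every \<open>d W\<close>.\<close>
    obtain b where b: "?q b = peak ?q" "0 < peak ?q" using peak_attained[OF qD(2) x] by auto
    have "b \<in> supp ?q" using b by (simp add: supp_def)
    then obtain V where V: "V \<subseteq> supp p" "0 < gap V p" "b = c V"
      using supp_push_subset[OF pD(3,2), of c] by blast
    have fV: "finite V" using V(1) pD(2) finite_subset by blast
    have chopV: "supp (chop p) \<subseteq> V"
      using supp_chop_subset(1)[OF pD(3,2)] gap_pos_ge_peak[OF pD(2) fV V(2)] by blast
    have chop_ne: "supp (chop p) \<noteq> {}" by (rule supp_nonempty[OF chop_simplex[OF pD(3,2)]])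
    then have VK: "V \<in> ?K" using simplicialD(3)[OF K pD(1) V(1)] chopV by blast
    have dW: "a \<in> A \<and> R a b" if a: "a \<in> supp (push d ?q)" for a
    proof -
      obtain W where W: "W \<subseteq> supp ?q" "0 < gap W ?q" "a = d W"
        using a supp_push_subset[OF qD(3,2), of d] by blast
      have fW: "finite W" using W(1) qD(2) finite_subset by blast
      have "b \<in> W" using gap_pos_ge_peak[OF qD(2) fW W(2), of b] b by simp
      then show ?thesis using simplicialD(3)[OF L qD(1) W(1)] d W(3) by blast
    qed
    have "finite (supp (push d ?q))"
      using finite_subset[OF supp_push_subset[OF qD(3,2), of d]] qD(2) by simp
    then show "supp (chop p) \<union> supp ((push d \<circ> push c) p) \<in> ?K"
      using dW chopV chop_ne VK c[OF VK] V(3) finite_subset[OF chopV fV]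
      unfolding dowker_def by auto
  next
    fix \<sigma> assume \<sigma>: "\<sigma> \<in> ?K"
    note fin = simplicialD(1)[OF K \<sigma>]
    have "supp (chop p) \<subseteq> \<sigma> \<and> supp ((push d \<circ> push c) p) \<subseteq> d ` Pow (c ` Pow \<sigma>)" if p: "p \<in> simplex_pts \<sigma>" for p
    proof -
      have q: "push c p \<in> realization_carrier ?L" 
        using push_dowker_carrier[of A B R c, OF c carrierI[OF \<sigma> p]] by simp
      note qD = simplicial_carrierD[OF L q]
      have "supp (push c p) \<subseteq> c ` Pow \<sigma>"
        using supp_push_subset[OF p fin, of c] simplex_ptsD(2)[OF p] by blast
      then have "supp (push d (push c p)) \<subseteq> d ` Pow (c ` Pow \<sigma>)"
        using supp_push_subset[OF qD(3,2), of d] by blast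
      then show ?thesis
        using supp_chop_subset(2)[OF p fin] simplex_ptsD(2)[OF p] by auto
    qed
    then show "\<exists>F. finite F \<and> (\<forall>p\<in>simplex_pts \<sigma>. supp (chop p) \<subseteq> F \<and> supp ((push d \<circ> push c) p) \<subseteq> F)"
      using fin by (intro exI[of _ "\<sigma> \<union> d ` Pow (c ` Pow \<sigma>)"]) auto
  qed
  from homotopic_with_trans[OF chop_homotopic_id[OF K] this] show ?thesis
    by (rule homotopic_with_symD)
qed

text \<open>The situation is symmetric under exchanging \<open>A\<close> and \<open>B\<close> and
  transposing \<open>R\<close>, so the same homotopy serves both round trips.\<close>

theorem dowker_duality:
  "weak_realization (dowker A B R) homotopy_equivalent_space weak_realization (dowker B A (\<lambda>b a. R a b))"
proof -
  obtain c where c: "\<And>\<sigma>. \<sigma> \<in> dowker A B R \<Longrightarrow> c \<sigma> \<in> B \<and> (\<forall>a\<in>\<sigma>. R a (c \<sigma>))"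
    by (rule that[of "\<lambda>\<sigma>. SOME b. b \<in> B \<and> (\<forall>a\<in>\<sigma>. R a b)"], rule someI_ex) (auto simp: dowker_def)
  obtain d where d: "\<And>\<tau>. \<tau> \<in> dowker B A (\<lambda>b a. R a b) \<Longrightarrow> d \<tau> \<in> A \<and> (\<forall>b\<in>\<tau>. R (d \<tau>) b)"
    by (rule that[of "\<lambda>\<tau>. SOME a. a \<in> A \<and> (\<forall>b\<in>\<tau>. R a b)"], rule someI_ex) (auto simp: dowker_def)
  show ?thesis
    unfolding homotopy_equivalent_space_def
    using continuous_map_push_dowker[of A B R c, OF c] continuous_map_push_dowker[of B A "\<lambda>b a. R a b" d, OF d]
      push_push_homotopic_id[of A B R c d, OF c d] push_push_homotopic_id[of B A "\<lambda>b a. R a b" d c, OF d c]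
    by (intro exI[of _ "push c"] exI[of _ "push d"]) simp
qed

section \<open>The nerve theorem for compact metric spaces\<close>

definition nerve :: "'a set set \<Rightarrow> 'a set set set" where
  "nerve \<U> = {V. finite V \<and> V \<noteq> {} \<and> V \<subseteq> \<U> \<and> \<Inter>V \<noteq> {}}"

lemma simplicial_nerve: "simplicial (nerve \<U>)"
  unfolding simplicial_def nerve_def by (blast intro: finite_subset)

text \<open>Normalising constant for the contraction times: division by the largest gap, not by the
  sum of the gaps, makes one contraction run to its end.\<close>

definition peakgap :: "('u \<Rightarrow> real) \<Rightarrow> real" where
  "peakgap p = Max (insert 0 ((\<lambda>V. gap V p) ` Pow (supp p)))"

text \<open>Given contractions \<open>H V\<close> of the intersections \<open>\<Inter>V\<close>, \<open>flow\<close> applies them along the chain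
  of superlevel sets of \<open>p\<close>, the largest set first, each for a time proportional to
  its gap. Since some set of the chain is contracted for the full time \<open>1\<close> if \<open>s = 1\<close>, the
  end point is then independent of the starting point.\<close>

definition stage :: "('u set \<Rightarrow> real \<times> 'a \<Rightarrow> 'a) \<Rightarrow> nat \<Rightarrow> ('u \<Rightarrow> real) \<Rightarrow> real \<Rightarrow> 'a \<Rightarrow> 'a" where
  "stage H n p s x =
    (if \<exists>V. finite V \<and> card V = n \<and> 0 < gap V p
     then let V = SOME V. finite V \<and> card V = n \<and> 0 < gap V p in H V (s * (gap V p / peakgap p), x)
     else x)"

primrec flow :: "('u set \<Rightarrow> real \<times> 'a \<Rightarrow> 'a) \<Rightarrow> nat \<Rightarrow> ('u \<Rightarrow> real) \<Rightarrow> real \<Rightarrow> 'a \<Rightarrow> 'a" where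
  "flow H 0 p s x = x"
| "flow H (Suc n) p s x = flow H n p s (stage H (Suc n) p s x)"

section \<open>The chain of superlevel sets, indexed by cardinality\<close>

lemma gap_pos_unique:
  assumes "finite (supp p)" "finite V" "0 < gap V p" "finite W" "card V = card W"
    "\<And>x y. x \<in> W \<Longrightarrow> y \<notin> W \<Longrightarrow> p y \<le> p x"
  shows "V = W"
  using gap_pos_comparable[OF assms(1-3,6)] assms(2,4,5) by (metis card_subset_eq)

lemma gap_pos_chain:
  assumes "finite (supp p)" "finite V" "0 < gap V p" "finite W" "0 < gap W p" "card V \<le> card W"
  shows "V \<subseteq> W"
proof -
  have "V \<subseteq> W \<or> W \<subseteq> V"
    using gap_pos_comparable[OF assms(1-3)] gap_pos_superlevel[OF assms(1,4,5)] by (meson less_imp_le)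
  then show ?thesis using assms(2,6) card_seteq by blast
qed

text \<open>Sets of positive gap form a chain, so each cardinality occurs at most once and the
  choice in \<open>stage\<close> is forced.\<close>

lemma stage_eq:
  assumes "finite (supp p)" "finite V" "0 < gap V p"
  shows "stage H (card V) p s x = H V (s * (gap V p / peakgap p), x)"
proof -
  let ?W = "SOME W. finite W \<and> card W = card V \<and> 0 < gap W p"
  have W: "finite ?W \<and> card ?W = card V \<and> 0 < gap ?W p"
    using someI[of "\<lambda>W. finite W \<and> card W = card V \<and> 0 < gap W p" V] assms by blast
  have "?W = V"
    using gap_pos_chain[OF assms(1), of ?W V] gap_pos_chain[OF assms, of ?W] W assms by simp
  moreover have "\<exists>W. finite W \<and> card W = card V \<and> 0 < gap W p" using assms by blast
  ultimately show ?thesis by (simp add: stage_def)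
qed

lemma stage_idle:
  assumes "\<And>V. finite V \<Longrightarrow> card V = n \<Longrightarrow> gap V p = 0"
  shows "stage H n p s x = x"
  using assms by (force simp: stage_def)

lemma stage_cases:
  assumes "finite (supp p)"
  obtains "stage H n p s x = x" "\<And>V. finite V \<Longrightarrow> card V = n \<Longrightarrow> gap V p = 0"
  | V where "finite V" "card V = n" "0 < gap V p" "stage H n p s x = H V (s * (gap V p / peakgap p), x)"
proof (cases "\<exists>V. finite V \<and> card V = n \<and> 0 < gap V p")
  case True
  then obtain V where "finite V" "card V = n" "0 < gap V p" by blast
  then show ?thesis using stage_eq[OF assms, of V H s x] by (intro that(2)[of V]) auto
next
  case False
  then have *: "gap V p = 0" if "finite V" "card V = n" for V
    using gap_nonneg[of V p] that by (force simp: less_le)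
  show ?thesis by (rule that(1)) (auto intro: stage_idle *)
qed

lemma peakgap_eq:
  assumes "finite F" "supp p \<subseteq> F"
  shows "peakgap p = Max (insert 0 ((\<lambda>V. gap V p) ` Pow F))"
proof -
  have "gap V p \<in> insert 0 ((\<lambda>V. gap V p) ` Pow (supp p))" if "V \<subseteq> F" for V
  proof (cases "0 < gap V p")
    case True
    then show ?thesis using gap_pos_subset_supp[of p V] assms that finite_subset by blast
  next
    case False
    then show ?thesis using gap_nonneg[of V p] by simp
  qed
  then have "insert 0 ((\<lambda>V. gap V p) ` Pow F) \<subseteq> insert 0 ((\<lambda>V. gap V p) ` Pow (supp p))"
    by (intro insert_subsetI image_subsetI) auto
  moreover have "insert 0 ((\<lambda>V. gap V p) ` Pow (supp p)) \<subseteq> insert 0 ((\<lambda>V. gap V p) ` Pow F)"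
    by (intro insert_mono image_mono Pow_mono assms(2))
  ultimately have "insert 0 ((\<lambda>V. gap V p) ` Pow (supp p)) = insert 0 ((\<lambda>V. gap V p) ` Pow F)"
    by (rule subset_antisym[rotated])
  then show ?thesis by (simp add: peakgap_def)
qed

lemma gap_le_peakgap:
  assumes "finite (supp p)" "finite V"
  shows "gap V p \<le> peakgap p"
proof -
  have "peakgap p = Max (insert 0 ((\<lambda>V. gap V p) ` Pow (supp p \<union> V)))"
    using assms by (intro peakgap_eq) auto
  then show ?thesis using assms by simp
qed

lemma peakgap_attained:
  assumes "finite (supp p)" "p x > 0"
  shows "0 < peakgap p" "\<exists>V. finite V \<and> gap V p = peakgap p"
proof -
  show "0 < peakgap p"
    using gap_half_peak_pos[OF assms] gap_le_peakgap[OF assms(1)] less_le_trans by blast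
  moreover have "peakgap p \<in> insert 0 ((\<lambda>V. gap V p) ` Pow (supp p))"
    unfolding peakgap_def using assms(1) by (intro Max_in) simp_all
  ultimately obtain V where "V \<subseteq> supp p" "peakgap p = gap V p" by auto
  then show "\<exists>V. finite V \<and> gap V p = peakgap p"
    using assms(1) finite_subset by metis
qed

lemma gap_ratio_bounds:
  assumes "finite (supp p)" "finite V" "s \<in> {0..1}"
  shows "s * (gap V p / peakgap p) \<in> {0..1}"
proof -
  have "0 \<le> gap V p / peakgap p" "gap V p / peakgap p \<le> 1"
    using gap_le_peakgap[OF assms(1,2)] order_trans[OF gap_nonneg[of V p] gap_le_peakgap[OF assms(1,2)]]
    by (auto simp: divide_le_eq_1)
  then show ?thesis
    unfolding atLeastAtMost_iff
    by (intro conjI mult_nonneg_nonneg mult_le_one) (use assms(3) in auto)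
qed

text \<open>Invariant of the flow before the stages \<open>n, ..., 1\<close>: the contraction
  \<open>H V\<close> is controlled only on \<open>\<Inter>V\<close>, so the point has to lie in
  \<open>\<Inter>V\<close> for every set still to be used.\<close>

definition ready :: "nat \<Rightarrow> ('a set \<Rightarrow> real) \<Rightarrow> 'a \<Rightarrow> bool" where
  "ready n p x \<longleftrightarrow> (\<forall>V. finite V \<and> 0 < gap V p \<and> card V \<le> n \<longrightarrow> x \<in> \<Inter>V)"

locale contracted_nerve =
  fixes \<U> :: "'a::topological_space set set" and H :: "'a set set \<Rightarrow> real \<times> 'a \<Rightarrow> 'a" and z :: "'a set set \<Rightarrow> 'a"
  assumes H_cont: "V \<in> nerve \<U> \<Longrightarrow> continuous_on ({0..1} \<times> \<Inter>V) (H V)"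
    and H_into: "V \<in> nerve \<U> \<Longrightarrow> t \<in> {0..1} \<Longrightarrow> x \<in> \<Inter>V \<Longrightarrow> H V (t, x) \<in> \<Inter>V"
    and H_0: "V \<in> nerve \<U> \<Longrightarrow> x \<in> \<Inter>V \<Longrightarrow> H V (0, x) = x"
    and H_1: "V \<in> nerve \<U> \<Longrightarrow> x \<in> \<Inter>V \<Longrightarrow> H V (1, x) = z V"
begin

context
  fixes p
  assumes p: "p \<in> realization_carrier (nerve \<U>)"
begin

lemma fin_supp: "finite (supp p)"
  by (rule simplicial_carrierD(2)[OF simplicial_nerve p])

lemma some_pos: "\<exists>x. p x > 0"
  by (rule simplex_pts_pos[OF simplicial_carrierD(3)[OF simplicial_nerve p] fin_supp])

lemma gap_pos_nerve:
  assumes "finite V" "0 < gap V p"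
  shows "V \<in> nerve \<U>"
proof -
  have "V \<noteq> {}" using some_pos gap_pos_nonempty[OF fin_supp assms] by blast
  then show ?thesis
    using gap_pos_subset_supp[OF fin_supp assms] simplicial_carrierD(1)[OF simplicial_nerve p]
      simplicialD(3)[OF simplicial_nerve] by blast
qed

lemma ready_supp: "x \<in> \<Inter>(supp p) \<Longrightarrow> ready n p x"
  using gap_pos_subset_supp[OF fin_supp] unfolding ready_def by blast

text \<open>This is why the largest set goes first: the set \<open>W\<close> used now contains all
  those that follow, so a point moved inside \<open>\<Inter>W\<close> remains in the larger
  intersections needed later.\<close>

lemma stage_ready:
  assumes "ready (Suc n) p x" "s \<in> {0..1}"
  shows "ready n p (stage H (Suc n) p s x)"
  unfolding ready_def
proof (intro allI impI)
  fix V assume V: "finite V \<and> 0 < gap V p \<and> card V \<le> n"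
  show "stage H (Suc n) p s x \<in> \<Inter>V"
  proof (cases rule: stage_cases[OF fin_supp, of H "Suc n" s x])
    case 1
    then show ?thesis using assms V by (auto simp: ready_def)
  next
    case (2 W)
    have "x \<in> \<Inter>W" using assms 2 by (auto simp: ready_def)
    then have "stage H (Suc n) p s x \<in> \<Inter>W"
      using 2 H_into[OF gap_pos_nerve gap_ratio_bounds[OF fin_supp]] assms(2) by simp
    moreover have "V \<subseteq> W"
      using gap_pos_chain[OF fin_supp, of V W] V 2 by simp
    ultimately show ?thesis by blast
  qed
qed

text \<open>Every \<open>W\<close> that acts contains the common core, so no stage leaves the
  intersection of the core. The end point is thereby tied to the simplex of
  \<open>chop p\<close>.\<close>

lemma flow_half_peak:
  assumes "ready n p x" "s \<in> {0..1}" "x \<in> \<Inter>{u. peak p / 2 \<le> p u}"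
  shows "flow H n p s x \<in> \<Inter>{u. peak p / 2 \<le> p u}"
  using assms
proof (induction n arbitrary: x)
  case (Suc n)
  have "stage H (Suc n) p s x \<in> \<Inter>{u. peak p / 2 \<le> p u}"
  proof (cases rule: stage_cases[OF fin_supp, of H "Suc n" s x])
    case 1
    then show ?thesis using Suc by simp
  next
    case (2 W)
    have "x \<in> \<Inter>W" using Suc 2 by (auto simp: ready_def)
    then have "stage H (Suc n) p s x \<in> \<Inter>W"
      using 2 H_into[OF gap_pos_nerve gap_ratio_bounds[OF fin_supp]] Suc.prems(2) by simp
    then show ?thesis using gap_pos_ge_peak[OF fin_supp 2(1,3)] by blast
  qed
  then show ?case using Suc.IH[OF stage_ready[OF Suc.prems(1,2)]] Suc.prems by simp
qed simp

lemma flow_time_0: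
  assumes "ready n p x"
  shows "flow H n p 0 x = x"
  using assms
proof (induction n arbitrary: x)
  case (Suc n)
  have "stage H (Suc n) p 0 x = x"
  proof (cases rule: stage_cases[OF fin_supp, of H "Suc n" 0 x])
    case (2 W)
    have "x \<in> \<Inter>W" using Suc 2 by (auto simp: ready_def)
    then show ?thesis using 2 H_0[OF gap_pos_nerve] by simp
  qed
  moreover have "ready n p x" using Suc.prems le_SucI[of _ n] unfolding ready_def by blast
  ultimately show ?case using Suc.IH[of x] by simp
qed simp

text \<open>For the set \<open>V\<close> of largest gap the time ratio is 1, so its stage sends
  every ready point to \<open>z V\<close>. Two orbits merge there and agree through the remaining
  stages.\<close>

lemma flow_time_1:
  assumes "ready n p x" "ready n p y" "finite V" "gap V p = peakgap p" "card V \<le> n"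
  shows "flow H n p 1 x = flow H n p 1 y"
  using assms
proof (induction n arbitrary: x y)
  case 0
  then have "0 < gap V p" using peakgap_attained(1)[OF fin_supp] some_pos by auto
  \<comment> \<open>A set of positive gap is nonempty, so \<open>card V \<le> 0\<close> is
    impossible and the base case is vacuous.\<close>
  then have "V \<noteq> {}" using some_pos gap_pos_nonempty[OF fin_supp 0(3)] by blast
  then show ?case using 0 by simp
next
  case (Suc n)
  have pos: "0 < gap V p" using peakgap_attained(1)[OF fin_supp] some_pos Suc.prems by auto
  show ?case
  proof (cases "card V = Suc n")
    case True
    have "stage H (Suc n) p 1 w = z V" if "ready (Suc n) p w" for w
    proof -
      have "w \<in> \<Inter>V" using that pos Suc.prems True by (auto simp: ready_def)
      then show ?thesis
        using stage_eq[OF fin_supp Suc.prems(3) pos, of H 1 w] H_1[OF gap_pos_nerve[OF Suc.prems(3) pos]]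
          pos True Suc.prems(4) by simp
    qed
    then show ?thesis using Suc.prems by simp
  next
    case False
    then show ?thesis
      using Suc.IH[OF stage_ready stage_ready Suc.prems(3,4)] Suc.prems by simp
  qed
qed

text \<open>Sets of positive gap lie in the support, so larger stages are idle. One number of stages
  can thus be used for all points of a closed simplex.\<close>

lemma flow_card_supp:
  assumes "card (supp p) \<le> n"
  shows "flow H n p s x = flow H (card (supp p)) p s x"
  using assms
proof (induction n arbitrary: x)
  case (Suc n)
  show ?case
  proof (cases "card (supp p) = Suc n")
    case False
    have "gap V p = 0" if "finite V" "card V = Suc n" for V
    proof (rule ccontr)
      assume "gap V p \<noteq> 0"
      then have "V \<subseteq> supp p"
        using gap_pos_subset_supp[OF fin_supp that(1)] gap_nonneg[of V p] by simp
      then show False using card_mono[OF fin_supp, of V] that False Suc.prems by simp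
    qed
    then have "stage H (Suc n) p s x = x" by (rule stage_idle)
    then show ?thesis using Suc False by simp
  qed simp
qed simp

end

text \<open>A stage is given by different formulas on different pieces, and \<open>H V\<close> is
  continuous only on \<open>\<Inter>V\<close>. The pieces must be closed for pasting, yet positivity
  of a gap is an open condition, and at a limit point the start could leave the open members of
  \<open>V\<close>. The closed sets \<open>P u\<close> exclude this; the last assumption is a closed
  form of readiness. The starting point \<open>e\<close> varies with \<open>y\<close>, so the
  induction can absorb one stage into it.\<close>

lemma continuous_on_flow:
  fixes Y :: "'y::topological_space set"
  assumes F: "finite F" "F \<subseteq> \<U>"
    and q: "\<And>y. y \<in> Y \<Longrightarrow> q y \<in> realization_carrier (nerve \<U>)" "\<And>y. y \<in> Y \<Longrightarrow> supp (q y) \<subseteq> F"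
      "\<And>u. continuous_on Y (\<lambda>y. q y u)"
    and s: "continuous_on Y s" "\<And>y. y \<in> Y \<Longrightarrow> s y \<in> {0..1}"
    and P: "\<And>u. u \<in> F \<Longrightarrow> closedin (top_of_set Y) (P u)" "\<And>y u. y \<in> Y \<Longrightarrow> u \<in> supp (q y) \<Longrightarrow> y \<in> P u"
    and e: "continuous_on Y e"
      "\<And>V y. V \<subseteq> F \<Longrightarrow> V \<noteq> {} \<Longrightarrow> card V \<le> n \<Longrightarrow> y \<in> Y \<Longrightarrow> y \<in> \<Inter>(P ` V) \<Longrightarrow>
          (\<And>u w. u \<in> V \<Longrightarrow> w \<notin> V \<Longrightarrow> q y w \<le> q y u) \<Longrightarrow> e y \<in> \<Inter>V"
  shows "continuous_on Y (\<lambda>y. flow H n (q y) (s y) (e y))"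
  using e
proof (induction n arbitrary: e)
  case 0
  then show ?case by simp
next
  case (Suc n)
  let ?X = "top_of_set Y"
  define e' where "e' y = stage H (Suc n) (q y) (s y) (e y)" for y
  define \<V> where "\<V> = {V. V \<subseteq> F \<and> card V = Suc n}"
  define A where "A V = Y \<inter> \<Inter>(P ` V) \<inter> (\<Inter>u\<in>V. \<Inter>w\<in>F-V. {y. q y w \<le> q y u})" for V
  define B where "B = Y \<inter> (\<Inter>V\<in>\<V>. {y. gap V (q y) = 0})"
  have fs: "finite (supp (q y))" if "y \<in> Y" for y
    using q(2)[OF that] F(1) finite_subset by blast
  have fin: "finite V" if "V \<subseteq> F" for V using that F(1) finite_subset by blast
  have A_le: "q y w \<le> q y u" if "y \<in> A V" "V \<subseteq> F" "u \<in> V" "w \<notin> V" for y V u w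
  proof (cases "w \<in> F")
    case True
    then show ?thesis using that by (auto simp: A_def)
  next
    case False
    have y: "y \<in> Y" using that(1) by (auto simp: A_def)
    then have "q y w = 0" using False q(2)[OF y] by (auto simp: supp_def)
    then show ?thesis using simplicial_carrierD(4)[OF simplicial_nerve q(1)[OF y]] by simp
  qed
  have eA: "e y \<in> \<Inter>V" "V \<in> nerve \<U>" "e' y = H V (s y * (gap V (q y) / peakgap (q y)), e y)"
    if y: "y \<in> A V" and V: "V \<in> \<V>" for y V
  proof -
    have yY: "y \<in> Y" "y \<in> \<Inter>(P ` V)" using y by (auto simp: A_def)
    have V': "V \<subseteq> F" "card V = Suc n" "V \<noteq> {}" using V by (auto simp: \<V>_def)
    show ey: "e y \<in> \<Inter>V"
      using Suc.prems(2)[OF V'(1,3) _ yY] A_le[OF y V'(1)] V'(2) by simp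
    then show VN: "V \<in> nerve \<U>"
      using V' fin F(2) unfolding nerve_def by blast
    show "e' y = H V (s y * (gap V (q y) / peakgap (q y)), e y)"
    proof (cases rule: stage_cases[OF fs[OF yY(1)], of H "Suc n" "s y" "e y"])
      case 1
      then have "gap V (q y) = 0" using fin V' by blast
      then show ?thesis using 1 H_0[OF VN ey] by (simp add: e'_def)
    next
      case (2 W)
      then have "W = V"
        \<comment> \<open>Even with ties in \<open>V\<close>, a set of positive gap is comparable
          with it; equal cardinality then forces equality.\<close>
        using gap_pos_unique[OF fs[OF yY(1)] 2(1,3) fin[OF V'(1)]] V'(1,2) A_le[OF y V'(1)] by simp
      then show ?thesis using 2 by (simp add: e'_def)
    qed
  qed
  have contgap: "continuous_on Y (\<lambda>y. gap V (q y))" if "V \<subseteq> F" for V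
    using continuous_on_gap[OF F(1) q(2,3) fin[OF that]] .
  have contpeak: "continuous_on Y (\<lambda>y. peakgap (q y))"
  proof -
    have "continuous_on Y (\<lambda>y. Max (insert 0 ((\<lambda>V. gap V (q y)) ` Pow F)))"
      using F(1) contgap by (intro continuous_on_Max_insert0) auto
    then show ?thesis
      by (rule continuous_on_eq) (simp add: peakgap_eq[OF F(1) q(2)])
  qed
  have peakpos: "peakgap (q y) \<noteq> 0" if "y \<in> Y" for y
    using peakgap_attained(1)[OF fs[OF that]] some_pos[OF q(1)[OF that]] by auto
  have "continuous_on Y e'"
  proof -
    have cA: "continuous_on (A V) e'" if V: "V \<in> \<V>" for V
    proof (cases "A V = {}")
      case False
      then have VN: "V \<in> nerve \<U>" using eA V by blast
      have AY: "A V \<subseteq> Y" and VF: "V \<subseteq> F" using V by (auto simp: A_def \<V>_def)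
      have "continuous_on (A V) (\<lambda>y. H V (s y * (gap V (q y) / peakgap (q y)), e y))"
      proof (rule continuous_on_compose2[OF H_cont[OF VN]])
        show "continuous_on (A V) (\<lambda>y. (s y * (gap V (q y) / peakgap (q y)), e y))"
          by (rule continuous_on_subset[OF _ AY])
            (intro continuous_on_Pair continuous_on_mult continuous_on_divide s contgap VF contpeak 
              ballI peakpos Suc.prems(1))
        show "(\<lambda>y. (s y * (gap V (q y) / peakgap (q y)), e y)) ` A V \<subseteq> {0..1} \<times> \<Inter>V"
        proof (intro image_subsetI SigmaI)
          fix y assume y: "y \<in> A V"
          then have "y \<in> Y" using AY by blast
          then show "s y * (gap V (q y) / peakgap (q y)) \<in> {0..1}"
            by (intro gap_ratio_bounds fs fin VF s)
          show "e y \<in> \<Inter>V" by (rule eA(1)[OF y V])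
        qed
      qed
      then show ?thesis by (rule continuous_on_eq) (simp add: eA(3)[OF _ V])
    qed simp
    have gap0: "gap V (q y) = 0" if "y \<in> B" "finite V" "card V = Suc n" for y V
    proof (rule ccontr)
      assume *: "gap V (q y) \<noteq> 0"
      have "y \<in> Y" using that by (auto simp: B_def)
      then have "V \<subseteq> F"
        using gap_pos_subset_supp[OF fs that(2)] q(2) * gap_nonneg[of V "q y"] by (metis less_le order_trans)
      then show False using * that by (auto simp: B_def \<V>_def)
    qed
    have cB: "continuous_on B e'"
      by (rule continuous_on_eq[OF continuous_on_subset[OF Suc.prems(1)]])
        (auto simp: e'_def B_def intro!: stage_idle[symmetric] gap0)
    have clB: "closedin ?X B"
    proof -
      have "closedin ?X (\<Inter>(insert Y ((\<lambda>V. Y \<inter> (\<lambda>y. gap V (q y)) -` {0}) ` \<V>)))"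
        using contgap by (intro closedin_Inter) (auto simp: \<V>_def intro!: continuous_closedin_preimage)
      also have "\<Inter>(insert Y ((\<lambda>V. Y \<inter> (\<lambda>y. gap V (q y)) -` {0}) ` \<V>)) = B"
        by (auto simp: B_def)
      finally show ?thesis .
    qed
    have clA: "closedin ?X (A V)" if V: "V \<in> \<V>" for V
    proof -
      have VF: "V \<subseteq> F" using V by (simp add: \<V>_def)
      let ?C = "\<lambda>(u, w). Y \<inter> (\<lambda>y. q y u - q y w) -` {0..}"
      have "closedin ?X (?C uw)" for uw
        using q(3) by (cases uw) (auto intro!: continuous_closedin_preimage continuous_on_diff)
      then have "closedin ?X (\<Inter>(insert Y (P ` V \<union> ?C ` (V \<times> (F - V)))))"
        using P(1) VF by (intro closedin_Inter) auto
      also have "\<Inter>(insert Y (P ` V \<union> ?C ` (V \<times> (F - V)))) = A V"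
        by (auto simp: A_def)
      finally show ?thesis .
    qed
    have "continuous_map ?X euclidean e'"
    proof (rule pasting_lemma_closed[where I = "insert B (A ` \<V>)" and T = id and f = "\<lambda>_. e'"])
      show "finite (insert B (A ` \<V>))" using F(1) by (simp add: \<V>_def)
      show "closedin ?X (id C)" if "C \<in> insert B (A ` \<V>)" for C
        using that clA clB by auto
      show "continuous_map (subtopology ?X (id C)) euclidean e'" if "C \<in> insert B (A ` \<V>)" for C
      proof -
        have "C \<subseteq> Y" using that by (auto simp: A_def B_def)
        then show ?thesis using that cA cB by (auto simp: subtopology_subtopology Int_absorb1)
      qed
      show "\<exists>C. C \<in> insert B (A ` \<V>) \<and> y \<in> id C \<and> e' y = e' y" if "y \<in> topspace ?X" for y
      proof (cases "y \<in> B")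
        case False
        have yY: "y \<in> Y" using that by simp
        with False obtain V where V: "V \<in> \<V>" "gap V (q y) \<noteq> 0" by (auto simp: B_def)
        then have VF: "V \<subseteq> F" and pos: "0 < gap V (q y)"
          by (simp_all add: \<V>_def less_le)
        have "y \<in> \<Inter>(P ` V)"
          using gap_pos_subset_supp[OF fs[OF yY] fin[OF VF] pos] P(2)[OF yY] by blast
        then have "y \<in> A V"
          using gap_pos_superlevel[OF fs[OF yY] fin[OF VF] pos] yY by (auto simp: A_def less_imp_le)
        then show ?thesis using V by auto
      qed auto
    qed auto
    then show ?thesis by simp
  qed
  \<comment> \<open>Closed readiness passes to the next stage: if some \<open>W\<close> of size
    \<open>Suc n\<close> acts, the smaller \<open>V\<close> is comparable with it, hence contained
    in it, and the new point lies in \<open>\<Inter>W\<close>.\<close>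
  moreover have "e' y \<in> \<Inter>V" if V: "V \<subseteq> F" "V \<noteq> {}" "card V \<le> n" and y: "y \<in> Y" "y \<in> \<Inter>(P ` V)"
    and le: "\<And>u w. u \<in> V \<Longrightarrow> w \<notin> V \<Longrightarrow> q y w \<le> q y u" for V y
  proof (cases rule: stage_cases[OF fs[OF y(1)], of H "Suc n" "s y" "e y"])
    case 1
    then show ?thesis using Suc.prems(2)[OF V(1,2) _ y le] V(3) by (simp add: e'_def)
  next
    case (2 W)
    have WF: "W \<subseteq> F"
      using gap_pos_subset_supp[OF fs[OF y(1)] 2(1,3)] q(2)[OF y(1)] by blast
    have "y \<in> A W"
      using gap_pos_superlevel[OF fs[OF y(1)] 2(1,3)] y(1) gap_pos_subset_supp[OF fs[OF y(1)] 2(1,3)] P(2)[OF y(1)]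
      by (auto simp: A_def less_imp_le subset_iff)
    moreover have "W \<in> \<V>" using WF 2 by (simp add: \<V>_def)
    ultimately have "e' y \<in> \<Inter>W"
      using eA[of y W] H_into[OF _ gap_ratio_bounds[OF fs[OF y(1)] 2(1) s(2)[OF y(1)]]] by simp
    moreover have "V \<subseteq> W"
      using gap_pos_comparable[OF fs[OF y(1)] 2(1,3) le] V(3) 2(2) card_mono[OF fin[OF V(1)], of W] by auto
    ultimately show ?thesis by blast
  qed
  ultimately have "continuous_on Y (\<lambda>y. flow H n (q y) (s y) (e' y))"
    by (rule Suc.IH)
  then show ?case by (simp add: e'_def)
qed

end

text \<open>Each point gets a radius whose closed ball, within \<open>X\<close>, lies in a chosen
  member of the cover. Finitely many of the open balls cover \<open>X\<close>, and the closed balls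
  assigned to \<open>u\<close> unite to a closed set \<open>P u\<close> inside \<open>u\<close>: the
  shrinking needed to control the flow.\<close>

lemma simplex_partition_of_unity:
  fixes X :: "'a::metric_space set"
  assumes X: "compact X" and op: "\<And>U. U \<in> \<U> \<Longrightarrow> openin (top_of_set X) U" and cov: "\<Union>\<U> = X"
  obtains F P \<phi> where "finite F" "F \<subseteq> \<U>" "\<And>u. closedin (top_of_set X) (P u)"
    "\<And>u. u \<in> F \<Longrightarrow> P u \<subseteq> u" "\<And>x. x \<in> X \<Longrightarrow> \<phi> x \<in> simplex_pts F"
    "\<And>x u. x \<in> X \<Longrightarrow> u \<in> supp (\<phi> x) \<Longrightarrow> x \<in> P u" "\<And>u. continuous_on X (\<lambda>x. \<phi> x u)"
proof -
  have "\<exists>u e. u \<in> \<U> \<and> 0 < e \<and> X \<inter> cball x e \<subseteq> u" if x: "x \<in> X" for x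
  proof -
    obtain u where u: "u \<in> \<U>" "x \<in> u" using x cov by blast
    then obtain e where "e > 0" "cball x e \<inter> X \<subseteq> u"
      using op[OF u(1)] unfolding openin_contains_cball by blast
    then show ?thesis using u by blast
  qed
  then obtain w e where we: "\<And>x. x \<in> X \<Longrightarrow> w x \<in> \<U> \<and> 0 < e x \<and> X \<inter> cball x (e x) \<subseteq> w x"
    by metis
  obtain D where D: "D \<subseteq> X" "finite D" "X \<subseteq> (\<Union>x\<in>D. ball x (e x))"
  proof (rule compactE_image[OF X, of X "\<lambda>x. ball x (e x)"])
    show "X \<subseteq> (\<Union>x\<in>X. ball x (e x))" using we by fastforce
  qed auto
  define F where "F = w ` D"
  define P where "P u = X \<inter> (\<Union>x\<in>{x \<in> D. w x = u}. cball x (e x))" for u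
  \<comment> \<open>Several centres may be assigned the same member \<open>u\<close>; their bump
    functions are added, so that the coordinates are indexed by members of the cover.\<close>
  define \<psi> where "\<psi> y u = (\<Sum>x | x \<in> D \<and> w x = u. max 0 (e x - dist x y))" for y u
  define S where "S y = (\<Sum>x\<in>D. max 0 (e x - dist x y))" for y
  define \<phi> where "\<phi> y u = \<psi> y u / S y" for y u
  have S_eq: "(\<Sum>u\<in>F. \<psi> y u) = S y" for y
    unfolding \<psi>_def S_def F_def
    using sum.group[of D "w ` D" w "\<lambda>x. max 0 (e x - dist x y)"] D(2) by simp
  have S_pos: "0 < S y" if y: "y \<in> X" for y
  proof -
    obtain x where "x \<in> D" "dist x y < e x" using subsetD[OF D(3) y] by auto
    then show ?thesis unfolding S_def using D(2) by (intro sum_pos2[where i = x]) auto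
  qed
  have nonneg: "0 \<le> \<psi> y u" "0 \<le> S y" for y u
    by (auto simp: \<psi>_def S_def intro!: sum_nonneg)
  have out: "\<psi> y u = 0" if "u \<notin> F" for y u
    unfolding \<psi>_def using that by (intro sum.neutral) (auto simp: F_def)
  have inP: "y \<in> P u" if y: "y \<in> X" and "u \<in> supp (\<phi> y)" for y u
  proof -
    have "\<psi> y u \<noteq> 0" using that by (auto simp: \<phi>_def supp_def)
    then obtain x where "x \<in> {x. x \<in> D \<and> w x = u}" "max 0 (e x - dist x y) \<noteq> 0"
      unfolding \<psi>_def by (rule sum.not_neutral_contains_not_neutral)
    then have "x \<in> D" "w x = u" "dist x y \<le> e x" by (auto simp: max_def split: if_splits)
    then show ?thesis using y by (auto simp: P_def)
  qed
  show ?thesis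
  proof (rule that[of F P \<phi>])
    show "finite F" "F \<subseteq> \<U>" using D we by (auto simp: F_def)
    show "closedin (top_of_set X) (P u)" for u
      unfolding P_def using D(2) by (intro closedin_closed_Int closed_UN) auto
    show "P u \<subseteq> u" if "u \<in> F" for u
      using we D(1) by (fastforce simp: P_def)
    show "\<phi> x \<in> simplex_pts F" if "x \<in> X" for x
      using S_pos[OF that] nonneg out
      by (auto simp: simplex_pts_def \<phi>_def S_eq simp flip: sum_divide_distrib)
    show "x \<in> P u" if "x \<in> X" "u \<in> supp (\<phi> x)" for x u
      using inP that by blast
    show "continuous_on X (\<lambda>x. \<phi> x u)" for u
      unfolding \<phi>_def \<psi>_def S_def
      by (intro continuous_intros ballI) (use S_pos in \<open>force simp: S_def\<close>)
  qed
qed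

theorem nerve_theorem:
  fixes X :: "'a::metric_space set"
  assumes X: "compact X" and op: "\<And>U. U \<in> \<U> \<Longrightarrow> openin (top_of_set X) U" and cov: "\<Union>\<U> = X"
    and good: "good_cover \<U>"
  shows "weak_realization (nerve \<U>) homotopy_equivalent_space top_of_set X"
proof -
  let ?N = "nerve \<U>"
  note N = simplicial_nerve[of \<U>]
  have "\<exists>h a. continuous_on ({0..1::real} \<times> \<Inter>V) h \<and> h \<in> ({0..1} \<times> \<Inter>V) \<rightarrow> \<Inter>V \<and>
      (\<forall>x. h (0, x) = x) \<and> (\<forall>x. h (1, x) = a)" if V: "V \<in> ?N" for V
  proof -
    have "contractible (\<Inter>V)"
      using V good unfolding good_cover_def nerve_def contractible_space_top_of_set by blast
    then show ?thesis
      by (auto simp: contractible_def homotopic_with_def)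
  qed
  then obtain H z where H: "\<And>V. V \<in> ?N \<Longrightarrow> continuous_on ({0..1::real} \<times> \<Inter>V) (H V) \<and>
      H V \<in> ({0..1} \<times> \<Inter>V) \<rightarrow> \<Inter>V \<and> (\<forall>x. H V (0, x) = x) \<and> (\<forall>x. H V (1, x) = z V)"
    by metis
  interpret contracted_nerve \<U> H z
  proof
    fix V t x assume V: "V \<in> ?N"
    show "continuous_on ({0..1} \<times> \<Inter>V) (H V)" "H V (0, x) = x" "H V (1, x) = z V" using H[OF V] by simp_all
    show "H V (t, x) \<in> \<Inter>V" if "t \<in> {0..1}" "x \<in> \<Inter>V"
      using H[OF V] that by (intro funcset_mem[of "H V" "{0..1} \<times> \<Inter>V"]) blast+
  qed
  have sub: "\<Inter>V \<subseteq> X" if "V \<subseteq> \<U>" "V \<noteq> {}" for V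
    using that cov by blast
  obtain F P \<phi> where F: "finite F" "F \<subseteq> \<U>"
    and P: "\<And>u. closedin (top_of_set X) (P u)" "\<And>u. u \<in> F \<Longrightarrow> P u \<subseteq> u"
    and \<phi>: "\<And>x. x \<in> X \<Longrightarrow> \<phi> x \<in> simplex_pts F" "\<And>x u. x \<in> X \<Longrightarrow> u \<in> supp (\<phi> x) \<Longrightarrow> x \<in> P u"
      "\<And>u. continuous_on X (\<lambda>x. \<phi> x u)"
    using simplex_partition_of_unity[OF X op cov] by metis
  have \<phi>F: "supp (\<phi> x) \<subseteq> F" if "x \<in> X" for x
    by (rule simplex_ptsD(2)[OF \<phi>(1)[OF that]])
  have x_in: "x \<in> \<Inter>(supp (\<phi> x))" if "x \<in> X" for x
    using \<phi>(2)[OF that] \<phi>F[OF that] P(2) by blast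
  have \<phi>N: "\<phi> x \<in> realization_carrier ?N" if x: "x \<in> X" for x
  proof (rule carrierI)
    note s = finite_subset[OF \<phi>F[OF x] F(1)]
    show "supp (\<phi> x) \<in> ?N"
      using s supp_nonempty[OF \<phi>(1)[OF x]] \<phi>F[OF x] F(2) x_in[OF x] unfolding nerve_def by blast
    show "\<phi> x \<in> simplex_pts (supp (\<phi> x))"
      using simplex_pts_mono[OF \<phi>(1)[OF x] s _ F(1)] by blast
  qed
  have cont\<phi>: "continuous_map (top_of_set X) (weak_realization ?N) \<phi>"
    by (rule continuous_map_into_weak_realization[OF N _ _ F(1)]) (use \<phi>N \<phi>F \<phi>(3) in auto)
  define g where "g p = flow H (card (supp p)) p 1 (SOME x. x \<in> \<Inter>(supp p))" for p
  have some_in: "(SOME x. x \<in> \<Inter>(supp p)) \<in> \<Inter>(supp p)" if "p \<in> realization_carrier ?N" for p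
    by (rule someI_ex) (use simplicial_carrierD(1)[OF N that] in \<open>auto simp: nerve_def\<close>)
  \<comment> \<open>The choice in \<open>g\<close> need not depend continuously on \<open>p\<close>.
    Since the end point is independent of the start and of idle stages, one start and one number of
    stages can be fixed on each closed simplex.\<close>
  have g_eq: "g p = flow H n p 1 x"
    if p: "p \<in> realization_carrier ?N" and n: "card (supp p) \<le> n" and x: "x \<in> \<Inter>(supp p)" for p n x
  proof -
    obtain u where "p u > 0" using some_pos[OF p] by blast
    then obtain V where V: "finite V" "gap V p = peakgap p" "0 < gap V p"
      using peakgap_attained[OF fin_supp[OF p]] by metis
    have "card V \<le> n"
      using card_mono[OF fin_supp[OF p] gap_pos_subset_supp[OF fin_supp[OF p] V(1,3)]] n by simp
    then show ?thesis
      unfolding g_def flow_card_supp[OF p n, symmetric]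
      by (intro flow_time_1[OF p ready_supp[OF p some_in[OF p]] ready_supp[OF p x] V(1,2)])
  qed
  have g_half: "g p \<in> \<Inter>{u. peak p / 2 \<le> p u}" and gX: "g p \<in> X" if p: "p \<in> realization_carrier ?N" for p
  proof -
    let ?V = "{u. peak p / 2 \<le> p u}"
    obtain u where u: "p u > 0" using some_pos[OF p] by blast
    note V = gap_half_peak_pos[OF fin_supp[OF p] u]
    have "?V \<subseteq> supp p" by (rule gap_pos_subset_supp[OF fin_supp[OF p] V])
    then show *: "g p \<in> \<Inter>?V"
      unfolding g_def using some_in[OF p]
      by (intro flow_half_peak[OF p ready_supp[OF p]]) auto
    show "g p \<in> X"
      using sub[of ?V] gap_pos_nerve[OF p V] * unfolding nerve_def by blast
  qed
  have contg: "continuous_map (weak_realization ?N) (top_of_set X) g"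
  proof (rule continuous_map_weak_realization)
    fix \<sigma> assume \<sigma>: "\<sigma> \<in> ?N"
    note fin = simplicialD(1)[OF N \<sigma>]
    obtain x where x: "x \<in> \<Inter>\<sigma>" using \<sigma> by (auto simp: nerve_def)
    \<comment> \<open>A constant start in \<open>\<Inter>\<sigma>\<close> lies in
      \<open>\<Inter>V\<close> for every face \<open>V\<close>, so no shrinking is required and
      \<open>P\<close> can be the whole simplex.\<close>
    have "continuous_on (simplex_pts \<sigma>) (\<lambda>p. flow H (card \<sigma>) p 1 x)"
    proof (rule continuous_on_flow[where F = \<sigma> and q = "\<lambda>p. p" and P = "\<lambda>_. simplex_pts \<sigma>"])
      show "\<sigma> \<subseteq> \<U>" using \<sigma> by (simp add: nerve_def)
      show "supp p \<subseteq> \<sigma>" if "p \<in> simplex_pts \<sigma>" for p by (rule simplex_ptsD(2)[OF that])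
    qed (use fin x carrierI[OF \<sigma>] in \<open>auto simp: continuous_on_coordinate\<close>)
    then have "continuous_on (simplex_pts \<sigma>) g"
    proof (rule continuous_on_eq)
      fix p assume p: "p \<in> simplex_pts \<sigma>"
      show "flow H (card \<sigma>) p 1 x = g p"
        using card_mono[OF fin simplex_ptsD(2)[OF p]] x simplex_ptsD(2)[OF p]
        by (intro g_eq[symmetric] carrierI[OF \<sigma> p]) auto
    qed
    then show "continuous_map (top_of_set (simplex_pts \<sigma>)) (top_of_set X) g"
      using gX carrierI[OF \<sigma>] by auto
  qed
  have "homotopic_with (\<lambda>_. True) (top_of_set X) (top_of_set X) id (g \<circ> \<phi>)"
  proof -
    \<comment> \<open>Here the start is the point \<open>x\<close> itself and moves with the
      parameter \<open>\<phi> x\<close>, so the closed sets \<open>P u\<close> are really used. Time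
      0 gives \<open>x\<close>, and time 1 gives \<open>g (\<phi> x)\<close> by independence of the
      start.\<close>
    define h where "h = (\<lambda>y. flow H (card F) (\<phi> (snd y)) (fst y) (snd y :: 'a))"
    let ?Y = "{0..1::real} \<times> X"
    have rdy: "ready n (\<phi> x) x" if "x \<in> X" for n x
      by (rule ready_supp[OF \<phi>N[OF that] x_in[OF that]])
    have "continuous_on ?Y h"
      unfolding h_def
    proof (rule continuous_on_flow[OF F, where P = "\<lambda>u. {0..1} \<times> P u"])
      show "continuous_on ?Y (\<lambda>y. \<phi> (snd y) u)" for u
        by (rule continuous_on_compose2[OF \<phi>(3)[of u]]) (auto intro: continuous_intros)
      show "closedin (top_of_set ?Y) ({0..1} \<times> P u)" for u
        by (intro closedin_Times P) simp
      show "snd y \<in> \<Inter>V" if "V \<subseteq> F" "y \<in> \<Inter>((\<lambda>u. {0..1} \<times> P u) ` V)" for V and y :: "real \<times> 'a"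
        using that P(2) by fastforce
      show "supp (\<phi> (snd y)) \<subseteq> F" if "y \<in> ?Y" for y
        by (rule \<phi>F) (use that in auto)
    qed (use \<phi>N \<phi>(2) in \<open>auto intro: continuous_intros\<close>)
    moreover have "h y \<in> X" if "y \<in> ?Y" for y
    proof -
      define x where "x = snd y"
      have x: "x \<in> X" "fst y \<in> {0..1}" using that by (auto simp: x_def)
      note p = \<phi>N[OF x(1)]
      let ?V = "{u. peak (\<phi> x) / 2 \<le> \<phi> x u}"
      obtain u where u: "\<phi> x u > 0" using some_pos[OF p] by blast
      note V = gap_half_peak_pos[OF fin_supp[OF p] u]
      have "?V \<subseteq> supp (\<phi> x)" by (rule gap_pos_subset_supp[OF fin_supp[OF p] V])
      then have "h y \<in> \<Inter>?V"
        unfolding h_def x_def[symmetric] using x_in[OF x(1)]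
        by (intro flow_half_peak[OF p rdy[OF x(1)] x(2)]) auto
      then show ?thesis
        using sub[of ?V] gap_pos_nerve[OF p V] unfolding nerve_def by blast
    qed
    moreover have "h (0, x) = x" if "x \<in> X" for x
      using flow_time_0[OF \<phi>N rdy] that by (simp add: h_def)
    moreover have "h (1, x) = g (\<phi> x)" if "x \<in> X" for x
      using g_eq[OF \<phi>N[OF that] card_mono[OF F(1) \<phi>F[OF that]] x_in[OF that]] by (simp add: h_def)
    ultimately have "\<exists>h. continuous_map (prod_topology (top_of_set {0..1::real}) (top_of_set X)) (top_of_set X) h \<and>
        (\<forall>x\<in>X. h (0, x) = x) \<and> (\<forall>x\<in>X. h (1, x) = g (\<phi> x))"
      by (intro exI[of _ h]) auto
    then show ?thesis by (simp add: homotopic_with)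
  qed
  then have 1: "homotopic_with (\<lambda>_. True) (top_of_set X) (top_of_set X) (g \<circ> \<phi>) id"
    by (rule homotopic_with_symD)
  have "homotopic_with (\<lambda>_. True) (weak_realization ?N) (weak_realization ?N) chop (\<phi> \<circ> g)"
  proof (rule homotopic_linear[OF N N])
    show "continuous_map (weak_realization ?N) (weak_realization ?N) chop"
      using homotopic_with_imp_continuous_maps[OF chop_homotopic_id[OF N]] by blast
    show "continuous_map (weak_realization ?N) (weak_realization ?N) (\<phi> \<circ> g)"
      by (rule continuous_map_compose[OF contg cont\<phi>])
  next
    fix p assume p: "p \<in> realization_carrier ?N"
    note pD = simplicial_carrierD[OF N p]
    \<comment> \<open>The point \<open>g p\<close> belongs to all members in both supports, so their
      union has nonempty intersection and is a simplex of the nerve.\<close>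
    have 1: "g p \<in> \<Inter>(supp (chop p))"
      using g_half[OF p] supp_chop_subset(1)[OF pD(3,2)] by blast
    have 2: "g p \<in> \<Inter>(supp (\<phi> (g p)))" by (rule x_in[OF gX[OF p]])
    have 3: "supp (chop p) \<subseteq> \<U>" "finite (supp (chop p))"
      using supp_chop_subset(2)[OF pD(3,2)] pD(1) finite_subset unfolding nerve_def by blast+
    have 4: "supp (\<phi> (g p)) \<subseteq> \<U>" "finite (supp (\<phi> (g p)))" "supp (\<phi> (g p)) \<noteq> {}"
      using simplicial_carrierD(1)[OF N \<phi>N[OF gX[OF p]]] unfolding nerve_def by blast+
    show "supp (chop p) \<union> supp ((\<phi> \<circ> g) p) \<in> ?N"
      using 1 2 3 4 unfolding nerve_def by auto
  next
    fix \<sigma> assume \<sigma>: "\<sigma> \<in> ?N"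
    note fin = simplicialD(1)[OF N \<sigma>]
    have "supp (chop p) \<subseteq> \<sigma> \<and> supp ((\<phi> \<circ> g) p) \<subseteq> F" if p: "p \<in> simplex_pts \<sigma>" for p
      using supp_chop_subset(2)[OF p fin] simplex_ptsD(2)[OF p] \<phi>F[OF gX[OF carrierI[OF \<sigma> p]]] by simp
    then show "\<exists>G. finite G \<and> (\<forall>p\<in>simplex_pts \<sigma>. supp (chop p) \<subseteq> G \<and> supp ((\<phi> \<circ> g) p) \<subseteq> G)"
      using fin F(1) by (intro exI[of _ "\<sigma> \<union> F"]) auto
  qed
  from homotopic_with_symD[OF homotopic_with_trans[OF chop_homotopic_id[OF N] this]]
  have 2: "homotopic_with (\<lambda>_. True) (weak_realization ?N) (weak_realization ?N) (\<phi> \<circ> g) id" .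
  show ?thesis
    unfolding homotopy_equivalent_space_def
    using contg cont\<phi> 1 2 by (intro exI[of _ g] exI[of _ \<phi>]) simp
qed

section \<open>Countable Rips complexes\<close>

lemma compact_countable_dense:
  fixes X :: "'a::metric_space set"
  assumes "compact X"
  obtains C where "countable C" "C \<subseteq> X" "\<And>U. openin (top_of_set X) U \<Longrightarrow> U \<noteq> {} \<Longrightarrow> U \<inter> C \<noteq> {}"
proof -
  have "\<exists>D. finite D \<and> D \<subseteq> X \<and> X \<subseteq> (\<Union>x\<in>D. ball x (1 / Suc n))" for n
    using assms by (simp add: compact_imp_seq_compact seq_compact_imp_totally_bounded)
  then obtain D where D: "\<And>n. finite (D n) \<and> D n \<subseteq> X \<and> X \<subseteq> (\<Union>x\<in>D n. ball x (1 / Suc n))"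
    by metis
  show ?thesis
  \<comment> \<open>The dense set is the union of finite nets of mesh
    \<open>1 / Suc n\<close>.\<close>
  proof (rule that[of "\<Union>n. D n"])
    show "countable (\<Union>n. D n)" using D by (blast intro: countable_finite)
    show "(\<Union>n. D n) \<subseteq> X" using D by blast
    fix U assume U: "openin (top_of_set X) U" "U \<noteq> {}"
    then obtain x where x: "x \<in> U" "x \<in> X" using openin_imp_subset by blast
    then obtain e where e: "e > 0" "ball x e \<inter> X \<subseteq> U"
      using U(1) unfolding openin_contains_ball by blast
    obtain n where n: "1 / Suc n < e" using e(1) nat_approx_posE by blast
    obtain y where y: "y \<in> D n" "x \<in> ball y (1 / Suc n)" using D[of n] x(2) by blast
    then have "y \<in> ball x e" using n by (simp add: dist_commute)
    then show "U \<inter> (\<Union>n. D n) \<noteq> {}" using e(2) y(1) D by blast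
  qed
qed

theorem mainTheorem15:
  fixes X :: "'a::metric_space set" and r :: real and \<U> :: "'a set set"
  assumes "compact X"
    and "r > 0"
    and "\<forall>U\<in>\<U>. openin (top_of_set X) U"
    and "\<Union>\<U> = X"
    and "good_cover \<U>"
    and "\<forall>\<sigma>. finite \<sigma> \<and> \<sigma> \<subseteq> X \<longrightarrow> ((\<exists>U\<in>\<U>. \<sigma> \<subseteq> U) \<longleftrightarrow> diameter \<sigma> < r)"
  shows "\<exists>C. C \<subseteq> X \<and> countable C \<and> Rips C r homotopy_equivalent_space top_of_set X"
proof -
  obtain C where C: "countable C" "C \<subseteq> X"
    and dense: "\<And>U. openin (top_of_set X) U \<Longrightarrow> U \<noteq> {} \<Longrightarrow> U \<inter> C \<noteq> {}"
    using compact_countable_dense[OF assms(1)] by blast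
  have "rips_simplices C r = dowker C \<U> (\<lambda>c U. c \<in> U)"
  proof -
    have "diameter \<sigma> < r \<longleftrightarrow> (\<exists>U\<in>\<U>. \<forall>c\<in>\<sigma>. c \<in> U)" if "finite \<sigma>" "\<sigma> \<subseteq> C" for \<sigma>
      using assms(6) C(2) that by (metis subset_eq subset_trans)
    then show ?thesis
      unfolding rips_simplices_def dowker_def by blast
  qed
  moreover have "dowker \<U> C (\<lambda>U c. c \<in> U) = nerve \<U>"
  proof -
    have eq: "\<Inter>V \<noteq> {} \<longleftrightarrow> (\<exists>c\<in>C. \<forall>U\<in>V. c \<in> U)" if V: "finite V" "V \<noteq> {}" "V \<subseteq> \<U>" for V
    proof -
      \<comment> \<open>Finiteness of \<open>V\<close> keeps the intersection open, and nonemptiness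
        keeps it inside \<open>X\<close>; density then supplies a witness in
        \<open>C\<close>.\<close>
      have "openin (top_of_set X) (\<Inter>V)"
        using V assms(3) by (intro openin_Inter) auto
      then show ?thesis using dense[of "\<Inter>V"] by blast
    qed
    show ?thesis
      unfolding nerve_def dowker_def by (intro Collect_cong conj_cong refl) (rule eq[symmetric])
  qed
  ultimately have "Rips C r homotopy_equivalent_space weak_realization (nerve \<U>)"
    using dowker_duality[of C \<U> "\<lambda>c U. c \<in> U"] by (simp add: Rips_def)
  also have "\<dots> homotopy_equivalent_space top_of_set X"
    using nerve_theorem[OF assms(1) _ assms(4,5)] assms(3) by blast
  finally show ?thesis using C by blast
qed

end
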